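(* Let $\sigma\in\mathfrak{S}_m$ and let $q>0$ be a real number; put $\bar q=\min(q,q^{-1})$. Then $$\lim_{n\to\infty} \frac{\displaystyle\sum_{\pi\in\mathfrak{I}_n(\sigma)} q^{\operatorname{maj}(\pi^{> m})} } {\displaystyle\sum_{\pi\in\mathfrak{I}_n} q^{\operatorname{maj}(\pi^{> m})}} =\frac{q^{\operatorname{maj}(\sigma)} + (1-\bar q)\,C}{[m]_q! + (1-\bar q)\,D},$$ where $C$ and $D$ are the following polynomials in $q$ and $\bar q$: $$C=\sum_{j\in J(\sigma),\ j\ge1} q^{\operatorname{maj}(\sigma^{>j})}\genfrac{[}{]}{0pt}{}{m}{j}_q [j]_q!\,(1-\bar q)^{j-1},\qquad D=[m]_q!\sum_{j=1}^m t_j\binom{m}{j}(1-\bar q)^{j-1}.$$ Equivalently, the limit equals $$\frac{\sum_{j\in J(\sigma)} q^{\operatorname{maj}(\sigma^{>j})}\genfrac{[}{]}{0pt}{}{m}{j}_q[j]_q!\,(1-\bar q)^j}{\sum_{j=0}^m [m]_q!\,t_j\binom{m}{j}(1-\bar q)^j}.$$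
   Context: $\mathfrak{S}_N$ is the set of permutations $\pi=\pi_1\cdots\pi_N$ of $[N]$ in one-line notation, $\mathfrak{I}_N$ the set of involutions in $\mathfrak{S}_N$ (identity included), and $t_j=|\mathfrak{I}_j|$. For $\pi\in\mathfrak{S}_N$ and $0\le k\le N$: $\pi_{\le k}\in\mathfrak{S}_k$ is order-isomorphic to the subword of $\pi$ consisting of the values $i\le k$; $\pi^{\le k}\in\mathfrak{S}_k$ is order-isomorphic to $\pi_1\cdots\pi_k$; $\pi^{>k}\in\mathfrak{S}_{N-k}$ is order-isomorphic to $\pi_{k+1}\cdots\pi_N$. For $\sigma\in\mathfrak{S}_m$, $\mathfrak{I}_N(\sigma)=\{\pi\in\mathfrak{I}_N:\pi_{\le m}=\sigma\}$, and $J(\sigma)=\{0\le j\le m:\sigma^{\le j}\text{ is an involution}\}$ (always $0\in J(\sigma)$). $\operatorname{maj}(\pi)$ is the sum of the descents of $\pi$, i.e. of all $i\in[N-1]$ with $\pi_i>\pi_{i+1}$. $[n]_q!=\prod_{i=1}^n(1+q+\cdots+q^{i-1})$ and $\genfrac{[}{]}{0pt}{}{n}{k}_q=\frac{[n]_q!}{[k]_q!\,[n-k]_q!}$. The convention $0^0=1$ is used. *)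

theory Defs
  imports Complex_Main "HOL-Combinatorics.Multiset_Permutations"
begin

text \<open>Permutations of \<open>{1..N}\<close> are represented by their one-line notation, as lists of
  naturals. List positions start at \<open>0\<close>, so the letter \<open>\<pi>\<^sub>i\<close> is \<open>\<pi> ! (i - 1)\<close>.\<close>

definition perms :: "nat \<Rightarrow> nat list set" where
  "perms N = permutations_of_set {1..N}"

definition involutions :: "nat \<Rightarrow> nat list set" where
  "involutions N = {\<pi> \<in> perms N. \<forall>i\<in>{1..N}. \<pi> ! (\<pi> ! (i - 1) - 1) = i}"

definition num_involutions :: "nat \<Rightarrow> nat" where
  "num_involutions j = card (involutions j)"

text \<open>For a word with distinct letters, this is the unique permutation order-isomorphic to it:
  every letter is replaced by its rank.\<close>

definition std :: "nat list \<Rightarrow> nat list" where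
  "std w = map (\<lambda>x. card {y \<in> set w. y \<le> x}) w"

text \<open>The three restrictions of a permutation: \<open>\<pi>\<^sub>\<le>\<^sub>k\<close> (by values), and
  \<open>\<pi>\<close> with superscript \<open>\<le> k\<close> and \<open>> k\<close> (by positions).\<close>

definition values_upto :: "nat \<Rightarrow> nat list \<Rightarrow> nat list" where
  "values_upto k \<pi> = std (filter (\<lambda>i. i \<le> k) \<pi>)"

definition pos_upto :: "nat \<Rightarrow> nat list \<Rightarrow> nat list" where
  "pos_upto k \<pi> = std (take k \<pi>)"

definition pos_after :: "nat \<Rightarrow> nat list \<Rightarrow> nat list" where
  "pos_after k \<pi> = std (drop k \<pi>)"

definition involutions_over :: "nat \<Rightarrow> nat list \<Rightarrow> nat list set" where
  "involutions_over N \<sigma> = {\<pi> \<in> involutions N. values_upto (length \<sigma>) \<pi> = \<sigma>}"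

definition J :: "nat list \<Rightarrow> nat set" where
  "J \<sigma> = {j. j \<le> length \<sigma> \<and> pos_upto j \<sigma> \<in> involutions j}"

definition descents :: "nat list \<Rightarrow> nat set" where
  "descents \<pi> = {i. 1 \<le> i \<and> i < length \<pi> \<and> \<pi> ! (i - 1) > \<pi> ! i}"

definition maj :: "nat list \<Rightarrow> nat" where
  "maj \<pi> = \<Sum>(descents \<pi>)"

definition qfact :: "real \<Rightarrow> nat \<Rightarrow> real" where
  "qfact q n = (\<Prod>i=1..n. \<Sum>k<i. q ^ k)"

definition qbinom :: "real \<Rightarrow> nat \<Rightarrow> nat \<Rightarrow> real" where
  "qbinom q n k = qfact q n / (qfact q k * qfact q (n - k))"

end

theory Submission imports Defs begin

text \<open>
  Let \<open>T\<^sub>k\<close> be the sum of \<open>q ^ maj \<tau>\<close> over the involutions \<open>\<tau>\<close> of \<open>{1..k}\<close>.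

  Take an involution \<open>\<pi>\<close> of \<open>{1..n}\<close> lying over \<open>\<sigma>\<close>, and let \<open>A\<close> be the set of those positions
  up to \<open>m\<close> that carry a letter up to \<open>m\<close>. As \<open>\<pi>\<close> is an involution it permutes \<open>A\<close>, so with
  \<open>j = card A\<close> the first \<open>j\<close> letters of \<open>\<sigma>\<close> are an involutive arrangement of \<open>A\<close>; hence
  \<open>j \<in> J \<sigma>\<close>. The remaining \<open>m - j\<close> letters of \<open>\<sigma>\<close> sit at positions beyond \<open>m\<close>, and the places of
  these letters force the letters at the positions in \<open>{1..m} - A\<close>. What is left is an involution of
  \<open>n - 2m + j\<close> points. So \<open>\<pi>\<close> is determined by its word beyond position \<open>m\<close>, and up to
  relabelling that word is an arbitrary shuffle of \<open>drop j \<sigma>\<close> with an involution on larger letters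
  (lemmas \<open>drop_bij_tails\<close> and \<open>relabel_bij\<close>). The Garsia--Gessel formula for the major index over
  a shuffle (\<open>sum_maj_shuffle\<close>) then gives the numerator as
  \<open>\<Sum>j\<in>J \<sigma>. q ^ maj (drop j \<sigma>) * qbinom q (n - m) (m - j) * T\<^bsub>n-2m+j\<^esub>\<close>.
  The denominator is the sum of the numerators over all \<open>\<sigma>\<close>; for fixed \<open>j\<close> the powers
  \<open>q ^ maj (drop j \<sigma>)\<close> add up to \<open>num_involutions j * (m choose j) * qfact q (m - j)\<close>, because
  the prefix and the suffix of \<open>\<sigma>\<close> are chosen independently and the major index of the suffix is
  governed by MacMahon's formula.

  Divide both sums by \<open>qfact q (n - m) * a\<^bsub>n-2m\<^esub>\<close> where \<open>a\<^sub>k = T\<^sub>k / qfact q k\<close>. All that is then needed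
  is that \<open>a\<^bsub>k+1\<^esub> / a\<^sub>k\<close> tends to \<open>1 - min q (1/q)\<close> (lemma \<open>ratio_limit\<close>). There are three cases.

  \<^item> For \<open>q < 1\<close> the numbers \<open>T\<^sub>k\<close> increase, since a new last fixed point does not change the
    major index, and they are bounded (\<open>signed_sum_bounded\<close>). Hence \<open>T\<^bsub>k+1\<^esub> / T\<^sub>k\<close> tends to \<open>1\<close>,
    while the \<open>q\<close>-integers tend to \<open>1 / (1 - q)\<close>. The bound comes from recording, for each
    position \<open>i\<close>, the number \<open>f i\<close> of descents from \<open>i\<close> on: the multiset of all pairs
    \<open>(f i, f (\<pi> i))\<close> determines the involution, and \<open>maj \<pi>\<close> is half the sum of the entries of the
    pairs, so that \<open>T\<^sub>k\<close> is at most a partial product of the convergent product of the geometric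
    series of \<open>q ^ ((a + b) / 2)\<close> over \<open>(a, b) \<noteq> (0, 0)\<close>.

  \<^item> For \<open>q > 1\<close> the sum of the ascents is complementary to the major index, and the same
    argument applies to ascents with \<open>1/q\<close> in place of \<open>q\<close>. Only the monotonicity needs a different
    insertion (\<open>grow_core_involution\<close>).

  \<^item> For \<open>q = 1\<close> the classical recurrence of the involution numbers, which is the case \<open>m = 1\<close>
    of the formula for the denominator, shows that their ratios grow like the square root.
\<close>

section \<open>Standardization and the major index\<close>

definition rank :: "nat set \<Rightarrow> nat \<Rightarrow> nat" where
  "rank S x = card {y \<in> S. y \<le> x}"

lemma std_eq_map_rank: "std w = map (rank (set w)) w"
  by (simp add: std_def rank_def)

lemma rank_strict_mono: "finite S \<Longrightarrow> strict_mono_on S (rank S)"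
  unfolding strict_mono_on_def rank_def
proof (intro allI impI)
  fix x y :: nat assume S: "finite S" and xy: "x \<in> S \<and> y \<in> S \<and> x < y"
  then have "y \<in> {z \<in> S. z \<le> y} - {z \<in> S. z \<le> x}" "{z \<in> S. z \<le> x} \<subseteq> {z \<in> S. z \<le> y}"
    by auto
  then have "{z \<in> S. z \<le> x} \<subset> {z \<in> S. z \<le> y}" by blast
  then show "card {z \<in> S. z \<le> x} < card {z \<in> S. z \<le> y}"
    using S by (intro psubset_card_mono) simp_all
qed

lemma rank_inj: "finite S \<Longrightarrow> inj_on (rank S) S"
  using rank_strict_mono strict_mono_on_imp_inj_on by blast

lemma rank_bij: assumes "finite S" shows "bij_betw (rank S) S {1..card S}"
proof -
  have sub: "rank S ` S \<subseteq> {1..card S}"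
  proof
    fix v assume "v \<in> rank S ` S"
    then obtain x where x: "x \<in> S" "v = card {y \<in> S. y \<le> x}" by (auto simp: rank_def)
    have "card {x} \<le> card {y \<in> S. y \<le> x}" by (rule card_mono) (use assms x in auto)
    moreover have "card {y \<in> S. y \<le> x} \<le> card S" by (rule card_mono) (use assms in auto)
    ultimately show "v \<in> {1..card S}" using x by auto
  qed
  have "rank S ` S = {1..card S}"
    by (rule card_subset_eq) (use sub rank_inj[OF assms] in \<open>auto simp: card_image\<close>)
  then show ?thesis using rank_inj[OF assms] by (simp add: bij_betw_def)
qed

text \<open>Ranks and the increasing enumeration are inverse to each other; this is what moves words on an
  arbitrary finite set to words on \<open>{1..k}\<close> and back.\<close>

lemma rank_sorted_nth:
  assumes "finite S" "i < card S"
  shows "rank S (sorted_list_of_set S ! i) = Suc i"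
proof -
  let ?l = "sorted_list_of_set S"
  have len: "length ?l = card S" by simp
  have "{y \<in> S. y \<le> ?l ! i} = set (take (Suc i) ?l)"
  proof
    show "{y \<in> S. y \<le> ?l ! i} \<subseteq> set (take (Suc i) ?l)"
    proof
      fix y assume y: "y \<in> {y \<in> S. y \<le> ?l ! i}"
      then have "y \<in> set ?l" using assms(1) by simp
      then obtain k where k: "k < length ?l" "?l ! k = y" unfolding in_set_conv_nth by blast
      have "k \<le> i"
      proof (rule ccontr)
        assume "\<not> k \<le> i"
        then have "?l ! i < ?l ! k"
          using strict_sorted_list_of_set[of S] k(1) by (simp add: sorted_wrt_iff_nth_less)
        with y k show False by simp
      qed
      then show "y \<in> set (take (Suc i) ?l)" using k
        by (auto simp: in_set_conv_nth intro!: exI[of _ k])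
    qed
    show "set (take (Suc i) ?l) \<subseteq> {y \<in> S. y \<le> ?l ! i}"
    proof
      fix y assume "y \<in> set (take (Suc i) ?l)"
      then obtain k where k: "k \<le> i" "?l ! k = y" using assms
        unfolding in_set_conv_nth by (auto simp: less_Suc_eq_le)
      have "?l ! k \<le> ?l ! i" using k assms by (intro sorted_nth_mono) auto
      moreover have "y \<in> S" using nth_mem[of k ?l] k assms by simp
      ultimately show "y \<in> {y \<in> S. y \<le> ?l ! i}" using k by auto
    qed
  qed
  then show ?thesis using assms by (simp add: rank_def distinct_card)
qed

lemma std_permutation:
  assumes "finite S" "x \<in> permutations_of_set S"
  shows "std x = map (rank S) x"
  using assms by (simp add: std_eq_map_rank permutations_of_setD)

text \<open>Standardization applies the order isomorphism \<open>rank S\<close> to every letter, so it is a bijection on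
  words.\<close>

lemma std_bij:
  assumes "finite S"
  shows "bij_betw std (permutations_of_set S) (perms (card S))"
proof -
  have img: "map (rank S) ` permutations_of_set S = perms (card S)"
    unfolding perms_def
    using permutations_of_set_image_inj[OF rank_inj[OF assms]] rank_bij[OF assms]
    by (simp add: bij_betw_def)
  have "inj_on (map (rank S)) (permutations_of_set S)"
  proof (rule inj_onI)
    fix x y assume "x \<in> permutations_of_set S" "y \<in> permutations_of_set S"
      and eq: "map (rank S) x = map (rank S) y"
    then have "set x = S" "set y = S" by (auto dest: permutations_of_setD)
    with eq show "x = y" using rank_inj[OF assms] by (simp add: inj_on_map_eq_map)
  qed
  with img have "bij_betw (map (rank S)) (permutations_of_set S) (perms (card S))"
    by (simp add: bij_betw_def)
  then show ?thesis
    by (rule bij_betw_cong[THEN iffD1, rotated]) (simp add: std_permutation[OF assms])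
qed

lemma rank_upto: "x \<le> N \<Longrightarrow> rank {1..N} x = x"
proof -
  assume "x \<le> N"
  then have "{y \<in> {1..N}. y \<le> x} = {1..x}" by auto
  then show ?thesis by (simp add: rank_def)
qed

lemma std_perms: "\<pi> \<in> perms N \<Longrightarrow> std \<pi> = \<pi>"
proof -
  assume "\<pi> \<in> perms N"
  then have \<pi>: "set \<pi> = {1..N}"
    by (auto simp: perms_def dest: permutations_of_setD)
  have "map (rank {1..N}) \<pi> = \<pi>"
    by (rule map_idI, rule rank_upto) (use \<pi> in auto)
  with \<pi> show ?thesis by (simp only: std_eq_map_rank)
qed

lemma maj_snoc: "maj (w @ [x]) = maj w + (if w \<noteq> [] \<and> last w > x then length w else 0)"
proof -
  have fin: "finite (descents w)"
    by (rule finite_subset[of _ "{..<length w}"]) (auto simp: descents_def)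
  have in_descents: "i \<in> descents (w @ [x]) \<longleftrightarrow>
      i \<in> descents w \<or> (w \<noteq> [] \<and> last w > x \<and> i = length w)" for i
  proof (cases "i = length w")
    case True
    have "i \<notin> descents w" by (simp add: True descents_def)
    moreover have "i \<in> descents (w @ [x]) \<longleftrightarrow> w \<noteq> [] \<and> last w > x"
      using True by (cases w rule: rev_cases) (simp_all add: descents_def nth_append)
    ultimately show ?thesis using True by simp
  next
    case False
    then have "i \<in> descents (w @ [x]) \<longleftrightarrow> i \<in> descents w"
      by (cases i; cases "i < length w") (simp_all add: descents_def nth_append)
    then show ?thesis using False by simp
  qed
  have "descents (w @ [x]) = descents w \<union> (if w \<noteq> [] \<and> last w > x then {length w} else {})"
    by (rule set_eqI) (simp add: in_descents)
  moreover have "length w \<notin> descents w" by (simp add: descents_def)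
  ultimately show ?thesis using fin by (simp add: maj_def)
qed

lemma maj_Nil [simp]: "maj [] = 0"
  by (simp add: maj_def descents_def)

lemma maj_single [simp]: "maj [x] = 0"
  using maj_snoc[of "[]" x] by simp

text \<open>The major index sees only the relative order of neighbouring letters. All relabellings below
  rest on this.\<close>

lemma maj_map:
  assumes "strict_mono_on (set w) f"
  shows "maj (map f w) = maj w"
proof -
  have "descents (map f w) = descents w"
    using strict_mono_on_less[OF assms] by (auto simp: descents_def)
  then show ?thesis by (simp add: maj_def)
qed

lemma maj_std: "maj (std w) = maj w"
  unfolding std_eq_map_rank by (rule maj_map) (simp add: rank_strict_mono)

section \<open>Involutions of a finite set of naturals as words\<close>

text \<open>A function that is an involution on \<open>S\<close>; nothing is said about its values elsewhere, so one function
  can serve several invariant sets.\<close>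

definition invol_on :: "nat set \<Rightarrow> (nat \<Rightarrow> nat) \<Rightarrow> bool" where
  "invol_on S p \<longleftrightarrow> (\<forall>i\<in>S. p i \<in> S \<and> p (p i) = i)"

text \<open>The words that describe an involution of \<open>S\<close>, with the positions indexed increasingly by \<open>S\<close>
  itself; this reading is justified by \<open>inv_words_iff\<close>.\<close>

definition inv_words :: "nat set \<Rightarrow> nat list set" where
  "inv_words S = {x \<in> permutations_of_set S. std x \<in> involutions (card S)}"

lemma involutions_perms: "\<pi> \<in> involutions N \<Longrightarrow> \<pi> \<in> perms N"
  by (simp add: involutions_def)

lemma perms_length: "\<pi> \<in> perms N \<Longrightarrow> length \<pi> = N"
  by (auto simp: perms_def dest: length_finite_permutations_of_set)

lemma perms_set: "\<pi> \<in> perms N \<Longrightarrow> set \<pi> = {1..N}"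
  by (auto simp: perms_def dest: permutations_of_setD)

lemma perms_distinct: "\<pi> \<in> perms N \<Longrightarrow> distinct \<pi>"
  by (auto simp: perms_def dest: permutations_of_setD)

lemma finite_perms [simp]: "finite (perms N)"
  by (simp add: perms_def)

lemma finite_involutions [simp]: "finite (involutions N)"
  by (simp add: involutions_def)

lemma invol_on_inj: "invol_on S p \<Longrightarrow> inj_on p S"
  unfolding invol_on_def by (metis inj_onI)

lemma invol_on_image: "invol_on S p \<Longrightarrow> p ` S = S"
  unfolding invol_on_def by force

lemma involutions_invol_on:
  assumes "\<pi> \<in> involutions N"
  shows "invol_on {1..N} (\<lambda>i. \<pi> ! (i - 1))" "\<pi> = map (\<lambda>i. \<pi> ! (i - 1)) [1..<Suc N]"
proof -
  note p = involutions_perms[OF assms]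
  have mem: "\<pi> ! (i - 1) \<in> {1..N}" if "i \<in> {1..N}" for i
  proof -
    have "i - 1 < length \<pi>" using that perms_length[OF p] by auto
    from nth_mem[OF this] show ?thesis by (simp only: perms_set[OF p])
  qed
  show "invol_on {1..N} (\<lambda>i. \<pi> ! (i - 1))"
    using assms mem by (auto simp: invol_on_def involutions_def)
  show "\<pi> = map (\<lambda>i. \<pi> ! (i - 1)) [1..<Suc N]"
    by (rule nth_equalityI) (use perms_length[OF p] in \<open>auto simp del: upt_Suc\<close>)
qed

lemma invol_on_involutions:
  assumes "invol_on {1..N} p"
  shows "map p [1..<Suc N] \<in> involutions N"
proof -
  have "p ` {1..<Suc N} = {1..N}"
    using invol_on_image[OF assms] by (simp add: atLeastLessThanSuc_atLeastAtMost)
  then have "map p [1..<Suc N] \<in> perms N"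
    using invol_on_inj[OF assms]
    by (auto simp: perms_def permutations_of_set_def distinct_map atLeastLessThanSuc_atLeastAtMost
        simp del: upt_Suc)
  moreover have "map p [1..<Suc N] ! (map p [1..<Suc N] ! (i - 1) - 1) = i" if "i \<in> {1..N}" for i
  proof -
    have "map p [1..<Suc N] ! (i - 1) = p i" using that by (auto simp del: upt_Suc)
    moreover have "p i \<in> {1..N}" "p (p i) = i" using assms that by (auto simp: invol_on_def)
    ultimately show ?thesis by (auto simp del: upt_Suc)
  qed
  ultimately show ?thesis by (simp add: involutions_def)
qed

lemma inv_words_std_bij:
  assumes "finite S"
  shows "bij_betw std (inv_words S) (involutions (card S))"
proof (rule bij_betwI')
  fix x y assume "x \<in> inv_words S" "y \<in> inv_words S"
  then show "std x = std y \<longleftrightarrow> x = y"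
    using std_bij[OF assms] by (auto simp: inv_words_def bij_betw_def inj_on_def)
next
  fix x assume "x \<in> inv_words S" then show "std x \<in> involutions (card S)"
    by (simp add: inv_words_def)
next
  fix y assume y: "y \<in> involutions (card S)"
  then have "y \<in> std ` permutations_of_set S"
    using std_bij[OF assms] by (simp add: bij_betw_def involutions_perms)
  with y show "\<exists>x\<in>inv_words S. y = std x" by (auto simp: inv_words_def)
qed

text \<open>If \<open>x\<close> places the letter \<open>r s\<close> at the position of rank \<open>rank S s\<close>, then \<open>std x\<close> is the conjugate of
  \<open>r\<close> by \<open>rank S\<close>, and conjugation preserves involutions.\<close>

lemma inv_words_iff:
  assumes "finite S"
  shows "x \<in> inv_words S \<longleftrightarrow> (\<exists>r. invol_on S r \<and> x = map r (sorted_list_of_set S))"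
proof -
  let ?l = "sorted_list_of_set S" and ?k = "card S"
  have nth_mem_S: "?l ! i \<in> S" if "i < ?k" for i
    using nth_mem[of i ?l] that assms by simp
  have rk: "rank S s \<in> {1..?k}" "?l ! (rank S s - 1) = s" if "s \<in> S" for s
  proof -
    show r: "rank S s \<in> {1..?k}" using bij_betwE[OF rank_bij[OF assms]] that by blast
    then have lt: "rank S s - 1 < ?k" by auto
    then have "?l ! (rank S s - 1) \<in> S" by (rule nth_mem_S)
    moreover have "rank S (?l ! (rank S s - 1)) = rank S s"
      using rank_sorted_nth[OF assms lt] r by simp
    ultimately show "?l ! (rank S s - 1) = s" using rank_inj[OF assms] that by (auto dest: inj_onD)
  qed
  show ?thesis
  proof
    assume x: "x \<in> inv_words S"
    then have xp: "x \<in> permutations_of_set S" and xi: "std x \<in> involutions ?k"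
      by (auto simp: inv_words_def)
    have len: "length x = ?k" using xp by (auto dest: length_finite_permutations_of_set)
    have xset: "set x = S" using xp by (rule permutations_of_setD)
    define r where "r = (\<lambda>s. x ! (rank S s - 1))"
    have rS: "r s \<in> S" if "s \<in> S" for s
    proof -
      have "rank S s - 1 < length x" using rk(1)[OF that] len by auto
      from nth_mem[OF this] show ?thesis by (simp only: r_def xset)
    qed
    have inv: "r (r s) = s" if s: "s \<in> S" for s
    proof -
      have sx: "std x ! (i - 1) = rank S (x ! (i - 1))" if "i \<in> {1..?k}" for i
        using that len by (auto simp: std_permutation[OF assms xp])
      have "rank S (r (r s)) = std x ! (rank S (r s) - 1)"
        using sx[OF rk(1)[OF rS[OF s]]] by (simp add: r_def)
      also have "rank S (r s) = std x ! (rank S s - 1)"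
        using sx[OF rk(1)[OF s]] by (simp add: r_def)
      also have "std x ! (std x ! (rank S s - 1) - 1) = rank S s"
        using xi rk(1)[OF s] by (auto simp: involutions_def)
      finally show ?thesis using rank_inj[OF assms] rS[OF rS[OF s]] s by (auto dest: inj_onD)
    qed
    have "x = map r ?l"
      by (rule nth_equalityI) (use len rank_sorted_nth[OF assms] in \<open>auto simp: r_def\<close>)
    with rS inv show "\<exists>r. invol_on S r \<and> x = map r ?l" by (auto simp: invol_on_def)
  next
    assume "\<exists>r. invol_on S r \<and> x = map r ?l"
    then obtain r where r: "invol_on S r" and x: "x = map r ?l" by blast
    have xp: "x \<in> permutations_of_set S"
      using invol_on_image[OF r] invol_on_inj[OF r] assms
      by (auto simp: x permutations_of_set_def distinct_map)
    have sp: "std x \<in> perms ?k" using std_bij[OF assms] xp by (auto simp: bij_betw_def)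
    have sx: "std x ! (rank S s - 1) = rank S (r s)" if "s \<in> S" for s
    proof -
      have "std x = map (rank S) x" by (rule std_permutation[OF assms xp])
      then show ?thesis using rk[OF that] by (auto simp: x)
    qed
    have "std x ! (std x ! (i - 1) - 1) = i" if "i \<in> {1..?k}" for i
    proof -
      obtain s where s: "s \<in> S" "i = rank S s"
        using rank_bij[OF assms] \<open>i \<in> {1..?k}\<close> unfolding bij_betw_def by blast
      then show ?thesis using r sx by (auto simp: invol_on_def)
    qed
    with sp xp show "x \<in> inv_words S" by (auto simp: inv_words_def involutions_def)
  qed
qed

section \<open>q-binomial coefficients\<close>

definition qint :: "real \<Rightarrow> nat \<Rightarrow> real" where "qint q n = (\<Sum>k<n. q ^ k)"

lemma qfact_0 [simp]: "qfact q 0 = 1" by (simp add: qfact_def)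

lemma qfact_Suc: "qfact q (Suc n) = qfact q n * qint q (Suc n)"
  by (simp add: qfact_def qint_def)

lemma qint_pos: "q > 0 \<Longrightarrow> n > 0 \<Longrightarrow> qint q n > 0"
  unfolding qint_def by (rule sum_pos) auto

lemma qfact_pos: "q > 0 \<Longrightarrow> qfact q n > 0"
  by (induction n) (simp_all add: qfact_Suc qint_pos)

lemma qint_add: "qint q (a + b) = qint q a + q ^ a * qint q b"
  by (induction b) (simp_all add: qint_def algebra_simps power_add)

lemma qbinom_0 [simp]: "q > 0 \<Longrightarrow> qbinom q n 0 = 1"
  using qfact_pos[of q n] by (simp add: qbinom_def)

lemma qbinom_self [simp]: "q > 0 \<Longrightarrow> qbinom q n n = 1"
  using qfact_pos[of q n] by (simp add: qbinom_def)

lemma qbinom_add: "qbinom q (a + b) a = qfact q (a + b) / (qfact q a * qfact q b)"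
  by (simp add: qbinom_def)

text \<open>There are two \<open>q\<close>-Pascal rules because \<open>qint q (a + b)\<close> can be split in two ways.
  The shuffle recursion uses one or the other according to whether a word ends in a descent.\<close>

lemma qbinom_pascal_left:
  assumes "q > 0"
  shows "qbinom q (Suc a + Suc b) (Suc a)
       = qbinom q (Suc a + b) (Suc a) + q ^ Suc b * qbinom q (a + Suc b) a"
proof -
  have e: "Suc a + Suc b = Suc (a + Suc b)" "Suc a + b = a + Suc b" by simp_all
  have "qint q (Suc (a + Suc b)) = qint q (Suc b) + q ^ Suc b * qint q (Suc a)"
    using qint_add[of q "Suc b" "Suc a"] by (simp add: add.commute)
  moreover have "qint q (Suc a) > 0" "qint q (Suc b) > 0" "qfact q a > 0" "qfact q b > 0"
    using assms by (auto intro: qint_pos qfact_pos)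
  ultimately show ?thesis
    unfolding qbinom_add unfolding e qfact_Suc by (simp add: field_simps)
qed

lemma qbinom_pascal_right:
  assumes "q > 0"
  shows "qbinom q (Suc a + Suc b) (Suc a)
       = q ^ Suc a * qbinom q (Suc a + b) (Suc a) + qbinom q (a + Suc b) a"
proof -
  have e: "Suc a + Suc b = Suc (a + Suc b)" "Suc a + b = a + Suc b" by simp_all
  have "qint q (Suc (a + Suc b)) = qint q (Suc a) + q ^ Suc a * qint q (Suc b)"
    using qint_add[of q "Suc a" "Suc b"] by simp
  moreover have "qint q (Suc a) > 0" "qint q (Suc b) > 0" "qfact q a > 0" "qfact q b > 0"
    using assms by (auto intro: qint_pos qfact_pos)
  ultimately show ?thesis
    unfolding qbinom_add unfolding e qfact_Suc by (simp add: field_simps)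
qed

section \<open>The major index over a shuffle\<close>

text \<open>Shuffles of \<open>u\<close> and \<open>v\<close> when the threshold \<open>c\<close> separates their letters. Given by the two
  filters, a shuffle keeps the words \<open>u\<close> and \<open>v\<close> recoverable.\<close>

definition shuffle_at :: "nat \<Rightarrow> nat list \<Rightarrow> nat list \<Rightarrow> nat list set" where
  "shuffle_at c u v = {w. filter (\<lambda>x. x \<le> c) w = u \<and> filter (\<lambda>x. c < x) w = v}"

lemma shuffle_at_length: "w \<in> shuffle_at c u v \<Longrightarrow> length w = length u + length v"
  using sum_length_filter_compl[of "\<lambda>x. x \<le> c" w] by (auto simp: shuffle_at_def not_le)

lemma shuffle_at_set: "w \<in> shuffle_at c u v \<Longrightarrow> set w = set u \<union> set v"
  by (auto simp: shuffle_at_def)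

lemma finite_shuffle_at [simp]: "finite (shuffle_at c u v)"
proof (rule finite_subset)
  show "shuffle_at c u v \<subseteq> {w. set w \<subseteq> set u \<union> set v \<and> length w = length u + length v}"
    using shuffle_at_length shuffle_at_set by blast
qed (simp add: finite_lists_length_eq)

lemma shuffle_at_Nil1: "\<forall>y\<in>set v. c < y \<Longrightarrow> shuffle_at c [] v = {v}"
  by (auto simp: shuffle_at_def filter_empty_conv)
    (metis filter_True leI not_le)+

lemma shuffle_at_Nil2: "\<forall>x\<in>set u. x \<le> c \<Longrightarrow> shuffle_at c u [] = {u}"
  by (auto simp: shuffle_at_def filter_empty_conv not_less)

lemma shuffle_at_snoc:
  assumes "x \<le> c" "c < y"
  shows "shuffle_at c (u @ [x]) (v @ [y])
       = (\<lambda>w. w @ [x]) ` shuffle_at c u (v @ [y]) \<union> (\<lambda>w. w @ [y]) ` shuffle_at c (u @ [x]) v"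
  (is "?L = ?R")
proof
  show "?R \<subseteq> ?L" using assms by (auto simp: shuffle_at_def)
  show "?L \<subseteq> ?R"
  proof
    fix w assume w: "w \<in> ?L"
    then have "w \<noteq> []" by (auto simp: shuffle_at_def)
    then obtain w' z where wz: "w = w' @ [z]" by (metis rev_exhaust)
    show "w \<in> ?R"
      using w assms unfolding wz by (cases "z \<le> c") (auto simp: shuffle_at_def)
  qed
qed

lemma sum_shuffle_at_snoc:
  assumes "x \<le> c" "c < y"
  shows "(\<Sum>w\<in>shuffle_at c (u @ [x]) (v @ [y]). f w)
       = (\<Sum>w\<in>shuffle_at c u (v @ [y]). f (w @ [x])) + (\<Sum>w\<in>shuffle_at c (u @ [x]) v. f (w @ [y]))"
proof -
  have "(\<lambda>w. w @ [x]) ` shuffle_at c u (v @ [y]) \<inter> (\<lambda>w. w @ [y]) ` shuffle_at c (u @ [x]) v = {}"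
    using assms by auto
  then show ?thesis unfolding shuffle_at_snoc[OF assms]
    by (subst sum.union_disjoint) (auto simp: sum.reindex inj_on_def)
qed

text \<open>The formula for the major index over a shuffle is proved in a refined form that fixes the last
  letter, since whether a word gains a descent when a letter is appended depends on its current
  last letter only. If the appended letter \<open>x\<close> is small, it follows either the last letter of \<open>u\<close>,
  where the descent is that of \<open>u @ [x]\<close>, or a letter of \<open>v\<close>, where there always is a descent;
  dually for a large \<open>y\<close>, where there is none after a letter of \<open>u\<close>. Both halves of the statement
  are needed together in the induction.\<close>

lemma sum_maj_shuffle_snoc:
  fixes q :: real
  assumes q: "q > 0" and u: "\<forall>x\<in>set u. x \<le> c" and v: "\<forall>y\<in>set v. c < y"
  shows "(x \<le> c \<longrightarrow> (\<Sum>w\<in>shuffle_at c u v. q ^ maj (w @ [x]))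
             = q ^ (maj (u @ [x]) + maj v + length v) * qbinom q (length u + length v) (length u))
       \<and> (c < y \<longrightarrow> (\<Sum>w\<in>shuffle_at c u v. q ^ maj (w @ [y]))
             = q ^ (maj u + maj (v @ [y])) * qbinom q (length u + length v) (length u))"
  using u v
proof (induction "length u + length v" arbitrary: u v x y rule: less_induct)
  case less
  show ?case
  proof (cases "u = [] \<or> v = []")
    case True
    then show ?thesis
    proof
      assume u: "u = []"
      have mx: "maj (v @ [x]) = maj v + length v" if "x \<le> c"
      proof (cases "v = []")
        case True
        then show ?thesis by simp
      next
        case False
        from bspec[OF less.prems(2) last_in_set[OF False]] that have "x < last v" by simp
        with False show ?thesis by (simp add: maj_snoc)
      qed
      have "shuffle_at c u v = {v}" using shuffle_at_Nil1[OF less.prems(2)] by (simp add: u)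
      then show ?thesis using mx q by (simp add: u)
    next
      assume v: "v = []"
      have my: "maj (u @ [y]) = maj u" if "c < y"
      proof (cases "u = []")
        case True
        then show ?thesis by simp
      next
        case False
        from bspec[OF less.prems(1) last_in_set[OF False]] that have "\<not> y < last u" by simp
        then show ?thesis by (simp add: maj_snoc)
      qed
      have "shuffle_at c u v = {u}" using shuffle_at_Nil2[OF less.prems(1)] by (simp add: v)
      then show ?thesis using my q by (simp add: v)
    qed
  next
    case False
    then obtain u' z v' t where uz: "u = u' @ [z]" and vt: "v = v' @ [t]"
      by (metis rev_exhaust)
    let ?a = "length u'" and ?b = "length v'"
    have z: "z \<le> c" and t: "c < t" using less.prems by (auto simp: uz vt)
    have IHU: "(\<Sum>w\<in>shuffle_at c u' v. q ^ maj (w @ [z]))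
          = q ^ (maj u + maj v + Suc ?b) * qbinom q (?a + Suc ?b) ?a"
      using less.hyps[of u' v z] less.prems z by (simp add: uz vt)
    have IHV: "(\<Sum>w\<in>shuffle_at c u v'. q ^ maj (w @ [t]))
          = q ^ (maj u + maj v) * qbinom q (Suc ?a + ?b) (Suc ?a)"
      using less.hyps[of u v' _ t] less.prems t by (simp add: uz vt)
    let ?n = "Suc ?a + Suc ?b"
    have len: "length u = Suc ?a" "length v = Suc ?b" by (simp_all add: uz vt)
    have split: "(\<Sum>w\<in>shuffle_at c u v. q ^ maj (w @ [s]))
        = q ^ (if s < z then ?n else 0) * (\<Sum>w\<in>shuffle_at c u' v. q ^ maj (w @ [z]))
        + q ^ (if s < t then ?n else 0) * (\<Sum>w\<in>shuffle_at c u v'. q ^ maj (w @ [t]))" for s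
    proof -
      have maj2: "maj (w @ [r, s]) = maj (w @ [r]) + (if s < r then Suc (length w) else 0)" for w r
        using maj_snoc[of "w @ [r]" s] by simp
      have "(\<Sum>w\<in>shuffle_at c u v. q ^ maj (w @ [s]))
        = (\<Sum>w\<in>shuffle_at c u' v. q ^ maj ((w @ [z]) @ [s]))
        + (\<Sum>w\<in>shuffle_at c u v'. q ^ maj ((w @ [t]) @ [s]))"
        using sum_shuffle_at_snoc[OF z t, of "\<lambda>w. q ^ maj (w @ [s])" u' v']
        by (simp add: uz vt)
      also have "(\<Sum>w\<in>shuffle_at c u' v. q ^ maj ((w @ [z]) @ [s]))
        = (\<Sum>w\<in>shuffle_at c u' v. q ^ (if s < z then ?n else 0) * q ^ maj (w @ [z]))"
        by (rule sum.cong) (auto simp: maj2 power_add shuffle_at_length vt)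
      also have "(\<Sum>w\<in>shuffle_at c u v'. q ^ maj ((w @ [t]) @ [s]))
        = (\<Sum>w\<in>shuffle_at c u v'. q ^ (if s < t then ?n else 0) * q ^ maj (w @ [t]))"
        by (rule sum.cong) (auto simp: maj2 power_add shuffle_at_length uz)
      finally show ?thesis by (simp only: sum_distrib_left)
    qed
    show ?thesis
    proof (intro conjI impI)
      assume x: "x \<le> c"
      have mx: "maj (u @ [x]) = maj u + (if x < z then Suc ?a else 0)"
        unfolding uz using maj_snoc[of "u' @ [z]" x] by (simp del: append_assoc)
      have xt: "x < t" using x t by simp
      show "(\<Sum>w\<in>shuffle_at c u v. q ^ maj (w @ [x]))
             = q ^ (maj (u @ [x]) + maj v + length v) * qbinom q (length u + length v) (length u)"
        unfolding split IHU IHV mx len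
      proof (cases "x < z")
        case True
        show "q ^ (if x < z then ?n else 0) * (q ^ (maj u + maj v + Suc ?b) * qbinom q (?a + Suc ?b) ?a)
            + q ^ (if x < t then ?n else 0) * (q ^ (maj u + maj v) * qbinom q (Suc ?a + ?b) (Suc ?a))
          = q ^ (maj u + (if x < z then Suc ?a else 0) + maj v + Suc ?b) * qbinom q ?n (Suc ?a)"
          unfolding qbinom_pascal_left[OF q] if_P[OF True] if_P[OF xt]
          by (simp add: power_add algebra_simps)
      next
        case False
        show "q ^ (if x < z then ?n else 0) * (q ^ (maj u + maj v + Suc ?b) * qbinom q (?a + Suc ?b) ?a)
            + q ^ (if x < t then ?n else 0) * (q ^ (maj u + maj v) * qbinom q (Suc ?a + ?b) (Suc ?a))
          = q ^ (maj u + (if x < z then Suc ?a else 0) + maj v + Suc ?b) * qbinom q ?n (Suc ?a)"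
          unfolding qbinom_pascal_right[OF q] if_not_P[OF False] if_P[OF xt]
          by (simp add: power_add algebra_simps)
      qed
    next
      assume y: "c < y"
      have my: "maj (v @ [y]) = maj v + (if y < t then Suc ?b else 0)"
        unfolding vt using maj_snoc[of "v' @ [t]" y] by (simp del: append_assoc)
      have yz: "\<not> y < z" using y z by simp
      show "(\<Sum>w\<in>shuffle_at c u v. q ^ maj (w @ [y]))
             = q ^ (maj u + maj (v @ [y])) * qbinom q (length u + length v) (length u)"
        unfolding split IHU IHV my len
      proof (cases "y < t")
        case True
        show "q ^ (if y < z then ?n else 0) * (q ^ (maj u + maj v + Suc ?b) * qbinom q (?a + Suc ?b) ?a)
            + q ^ (if y < t then ?n else 0) * (q ^ (maj u + maj v) * qbinom q (Suc ?a + ?b) (Suc ?a))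
          = q ^ (maj u + (maj v + (if y < t then Suc ?b else 0))) * qbinom q ?n (Suc ?a)"
          unfolding qbinom_pascal_right[OF q] if_P[OF True] if_not_P[OF yz]
          by (simp add: power_add algebra_simps)
      next
        case False
        show "q ^ (if y < z then ?n else 0) * (q ^ (maj u + maj v + Suc ?b) * qbinom q (?a + Suc ?b) ?a)
            + q ^ (if y < t then ?n else 0) * (q ^ (maj u + maj v) * qbinom q (Suc ?a + ?b) (Suc ?a))
          = q ^ (maj u + (maj v + (if y < t then Suc ?b else 0))) * qbinom q ?n (Suc ?a)"
          unfolding qbinom_pascal_left[OF q] if_not_P[OF False] if_not_P[OF yz]
          by (simp add: power_add algebra_simps)
      qed
    qed
  qed
qed

text \<open>The Garsia--Gessel formula for words separated by a threshold: splitting by the last letter, the two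
  halves of \<open>sum_maj_shuffle_snoc\<close> add up by the \<open>q\<close>-Pascal rule.\<close>

theorem sum_maj_shuffle:
  fixes q :: real
  assumes q: "q > 0" and u: "\<forall>x\<in>set u. x \<le> c" and v: "\<forall>y\<in>set v. c < y"
  shows "(\<Sum>w\<in>shuffle_at c u v. q ^ maj w)
       = q ^ (maj u + maj v) * qbinom q (length u + length v) (length u)"
proof (cases "u = [] \<or> v = []")
  case True
  then show ?thesis
  proof
    assume "u = []" then show ?thesis using shuffle_at_Nil1[OF v] q by simp
  next
    assume "v = []" then show ?thesis using shuffle_at_Nil2[OF u] q by simp
  qed
next
  case False
  then obtain u' z v' t where uz: "u = u' @ [z]" and vt: "v = v' @ [t]"
    by (metis rev_exhaust)
  have z: "z \<le> c" and t: "c < t" using u v by (auto simp: uz vt)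
  have "(\<Sum>w\<in>shuffle_at c u v. q ^ maj w)
      = (\<Sum>w\<in>shuffle_at c u' v. q ^ maj (w @ [z])) + (\<Sum>w\<in>shuffle_at c u v'. q ^ maj (w @ [t]))"
    using sum_shuffle_at_snoc[OF z t, of "\<lambda>w. q ^ maj w" u' v'] by (simp add: uz vt)
  also have "(\<Sum>w\<in>shuffle_at c u' v. q ^ maj (w @ [z]))
      = q ^ (maj u + maj v + length v) * qbinom q (length u' + length v) (length u')"
    using sum_maj_shuffle_snoc[OF q, of u' c v z] u v z by (simp add: uz)
  also have "(\<Sum>w\<in>shuffle_at c u v'. q ^ maj (w @ [t]))
      = q ^ (maj u + maj v) * qbinom q (length u + length v') (length u)"
    using sum_maj_shuffle_snoc[OF q, of u c v' _ t] u v t by (simp add: vt)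
  finally show ?thesis
    using qbinom_pascal_left[OF q, of "length u'" "length v'"]
    by (simp add: uz vt power_add algebra_simps)
qed

section \<open>Sums over all arrangements of a set\<close>

text \<open>MacMahon's formula. An arrangement of \<open>S\<close> is a shuffle of the one-letter word \<open>[Min S]\<close> with
  an arrangement of the rest, which contributes the factor \<open>qbinom q (k + 1) 1\<close>.\<close>

theorem sum_maj_permutations:
  fixes q :: real
  assumes q: "q > 0" and "finite S"
  shows "(\<Sum>w\<in>permutations_of_set S. q ^ maj w) = qfact q (card S)"
  using assms(2)
proof (induction "card S" arbitrary: S)
  case 0
  then show ?case by simp
next
  case (Suc k)
  then have "S \<noteq> {}" by auto
  define x where "x = Min S"
  have x: "x \<in> S" "\<And>y. y \<in> S - {x} \<Longrightarrow> x < y"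
    using Suc.prems \<open>S \<noteq> {}\<close> unfolding x_def by (auto simp: less_le)
  have card: "card (S - {x}) = k" using Suc.hyps(2) Suc.prems x by simp
  have eq: "permutations_of_set S = (\<Union>v\<in>permutations_of_set (S - {x}). shuffle_at x [x] v)"
  proof (intro equalityI subsetI)
    fix w assume "w \<in> permutations_of_set S"
    then have w: "set w = S" "distinct w" by (auto dest: permutations_of_setD)
    let ?v = "filter (\<lambda>y. x < y) w" and ?u = "filter (\<lambda>y. y \<le> x) w"
    have "y = x" if "y \<in> S" "y \<le> x" for y using x(2)[of y] that by (cases "y = x") auto
    then have su: "set ?u = {x}" using w x(1) by auto
    have "length ?u = 1" using distinct_card[of ?u] w su by simp
    then obtain a where "?u = [a]" by (auto simp: length_Suc_conv)
    with su have "?u = [x]" by simp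
    moreover have "set ?v = S - {x}" using w x by (auto)
    ultimately show "w \<in> (\<Union>v\<in>permutations_of_set (S - {x}). shuffle_at x [x] v)"
      using w by (auto simp: shuffle_at_def permutations_of_set_def)
  next
    fix w assume "w \<in> (\<Union>v\<in>permutations_of_set (S - {x}). shuffle_at x [x] v)"
    then obtain v where v: "set v = S - {x}" "distinct v" "w \<in> shuffle_at x [x] v"
      by (auto dest: permutations_of_setD)
    have "set w = S" using shuffle_at_set[OF v(3)] v(1) x by auto
    moreover have "length w = Suc k"
      using shuffle_at_length[OF v(3)] v card by (simp add: distinct_card[symmetric])
    ultimately show "w \<in> permutations_of_set S"
      using Suc.hyps(2) by (auto simp: permutations_of_set_def intro: card_distinct)
  qed
  have "(\<Sum>w\<in>permutations_of_set S. q ^ maj w)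
      = (\<Sum>v\<in>permutations_of_set (S - {x}). \<Sum>w\<in>shuffle_at x [x] v. q ^ maj w)"
  proof -
    have "shuffle_at x [x] v \<inter> shuffle_at x [x] v' = {}" if "v \<noteq> v'" for v v'
      using that by (auto simp: shuffle_at_def)
    then show ?thesis unfolding eq by (intro sum.UNION_disjoint) auto
  qed
  also have "\<dots> = (\<Sum>v\<in>permutations_of_set (S - {x}). q ^ maj v * qint q (Suc k))"
  proof (rule sum.cong[OF refl])
    fix v assume v: "v \<in> permutations_of_set (S - {x})"
    then have "set v = S - {x}" "length v = k"
      using card by (auto dest: permutations_of_setD length_finite_permutations_of_set)
    then have "(\<Sum>w\<in>shuffle_at x [x] v. q ^ maj w) = q ^ maj v * qbinom q (Suc k) 1"
      using sum_maj_shuffle[OF q, of "[x]" x v] x(2) by simp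
    moreover have "qbinom q (Suc k) 1 = qint q (Suc k)"
      using qfact_pos[OF q, of k] by (simp add: qbinom_def qfact_Suc qint_def)
    ultimately show "(\<Sum>w\<in>shuffle_at x [x] v. q ^ maj w) = q ^ maj v * qint q (Suc k)" by simp
  qed
  also have "\<dots> = qfact q k * qint q (Suc k)"
    using Suc.hyps(1)[of "S - {x}"] card Suc.prems by (simp add: sum_distrib_right[symmetric])
  finally show ?case by (simp add: Suc.hyps(2)[symmetric] qfact_Suc)
qed

text \<open>Choosing \<open>\<sigma>\<close> with \<open>j \<in> J \<sigma>\<close> amounts to choosing the set of its first \<open>j\<close> letters, an involutive
  arrangement of this set, and any arrangement of its complement. The exponent depends on the last
  choice only.\<close>

theorem sum_maj_involutive_prefix:
  fixes q :: real
  assumes q: "q > 0" and j: "j \<le> m"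
  shows "(\<Sum>\<sigma>\<in>{\<sigma> \<in> perms m. j \<in> J \<sigma>}. q ^ maj (drop j \<sigma>))
       = real (num_involutions j) * real (m choose j) * qfact q (m - j)"
proof -
  let ?As = "{A. A \<subseteq> {1..m} \<and> card A = j}"
  let ?B = "\<lambda>A. inv_words A \<times> permutations_of_set ({1..m} - A)"
  have "(\<Sum>\<sigma>\<in>{\<sigma> \<in> perms m. j \<in> J \<sigma>}. q ^ maj (drop j \<sigma>))
      = (\<Sum>(A, x, y)\<in>Sigma ?As ?B. q ^ maj y)"
  proof (rule sum.reindex_bij_witness[where i = "\<lambda>(A, x, y). x @ y"
        and j = "\<lambda>\<sigma>. (set (take j \<sigma>), take j \<sigma>, drop j \<sigma>)"])
    fix \<sigma> assume "\<sigma> \<in> {\<sigma> \<in> perms m. j \<in> J \<sigma>}"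
    then have s: "\<sigma> \<in> perms m" "j \<in> J \<sigma>" by auto
    have d: "distinct (take j \<sigma>)" "distinct (drop j \<sigma>)" "set (take j \<sigma>) \<inter> set (drop j \<sigma>) = {}"
      using perms_distinct[OF s(1)] by (simp_all add: set_take_disj_set_drop_if_distinct)
    have st: "set (take j \<sigma>) \<union> set (drop j \<sigma>) = {1..m}"
      using perms_set[OF s(1)] by (metis append_take_drop_id set_append)
    have cd: "card (set (take j \<sigma>)) = j"
      using distinct_card[OF d(1)] j perms_length[OF s(1)] by simp
    have diff: "{1..m} - set (take j \<sigma>) = set (drop j \<sigma>)" using d st by blast
    have i: "take j \<sigma> \<in> inv_words (set (take j \<sigma>))"
      using s(2) d cd by (simp add: inv_words_def permutations_of_set_def J_def pos_upto_def)
    have "drop j \<sigma> \<in> permutations_of_set ({1..m} - set (take j \<sigma>))"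
      unfolding diff using d by (simp add: permutations_of_set_def)
    with st cd i show "(set (take j \<sigma>), take j \<sigma>, drop j \<sigma>) \<in> Sigma ?As ?B"
      by blast
    show "(case (set (take j \<sigma>), take j \<sigma>, drop j \<sigma>) of (A, x, y) \<Rightarrow> x @ y) = \<sigma>" by simp
    show "(case (set (take j \<sigma>), take j \<sigma>, drop j \<sigma>) of (A, x, y) \<Rightarrow> q ^ maj y) = q ^ maj (drop j \<sigma>)"
      by simp
  next
    fix z assume "z \<in> Sigma ?As ?B"
    then obtain A x y where z: "z = (A, x, y)" and A: "A \<subseteq> {1..m}" "j = card A"
      and x: "x \<in> inv_words A" and y: "y \<in> permutations_of_set ({1..m} - A)"
      by auto
    have xp: "set x = A" "distinct x" "std x \<in> involutions (card A)"
      using x by (auto simp: inv_words_def dest: permutations_of_setD)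
    then have lx: "length x = card A" by (simp add: distinct_card[symmetric])
    note yp = permutations_of_setD[OF y]
    have "x @ y \<in> perms m"
      using A(1) xp yp by (auto simp: perms_def permutations_of_set_def)
    moreover have "card A \<in> J (x @ y)"
      using xp lx by (simp add: J_def pos_upto_def)
    ultimately show "(case z of (A, x, y) \<Rightarrow> x @ y) \<in> {\<sigma> \<in> perms m. j \<in> J \<sigma>}"
      by (simp add: z A)
    have "(set (take (card A) (x @ y)), take (card A) (x @ y), drop (card A) (x @ y)) = (A, x, y)"
      using xp lx by simp
    then show "(set (take j (case z of (A, x, y) \<Rightarrow> x @ y)), take j (case z of (A, x, y) \<Rightarrow> x @ y),
        drop j (case z of (A, x, y) \<Rightarrow> x @ y)) = z"
      by (simp only: z A(2) prod.case)
  qed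
  also have "\<dots> = (\<Sum>A\<in>?As. \<Sum>x\<in>inv_words A. \<Sum>y\<in>permutations_of_set ({1..m} - A). q ^ maj y)"
  proof -
    have fB: "finite (?B A)" if "A \<in> ?As" for A
      using that finite_subset[of A "{1..m}"] by (auto simp: inv_words_def)
    have "(\<Sum>(A, x, y)\<in>Sigma ?As ?B. q ^ maj y) = (\<Sum>A\<in>?As. \<Sum>(x, y)\<in>?B A. q ^ maj y)"
      using fB by (subst sum.Sigma) auto
    then show ?thesis by (simp only: sum.cartesian_product)
  qed
  also have "\<dots> = (\<Sum>A\<in>?As. real (num_involutions j) * qfact q (m - j))"
  proof (rule sum.cong[OF refl])
    fix A assume A: "A \<in> ?As"
    then have fin: "finite A" using finite_subset[of A "{1..m}"] by simp
    have "card ({1..m} - A) = m - j" using A fin by (simp add: card_Diff_subset)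
    moreover have "card (inv_words A) = num_involutions j"
      using bij_betw_same_card[OF inv_words_std_bij[OF fin]] A by (simp add: num_involutions_def)
    ultimately show "(\<Sum>x\<in>inv_words A. \<Sum>y\<in>permutations_of_set ({1..m} - A). q ^ maj y)
        = real (num_involutions j) * qfact q (m - j)"
      using sum_maj_permutations[OF q, of "{1..m} - A"] by simp
  qed
  also have "\<dots> = real (m choose j) * (real (num_involutions j) * qfact q (m - j))"
    using n_subsets[of "{1..m}" j] by simp
  finally show ?thesis by simp
qed

section \<open>Tails of involutions over a permutation\<close>

text \<open>The word \<open>w\<close> is thought of as occupying the positions \<open>m + 1, m + 2, \<dots>\<close>; positions are numbered
  accordingly.\<close>

definition large_positions :: "nat \<Rightarrow> nat list \<Rightarrow> nat set" where
  "large_positions m w = {i \<in> {m<..m + length w}. m < w ! (i - Suc m)}"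

text \<open>The words of length \<open>L\<close> that can follow the first \<open>m\<close> letters of an involution when \<open>u\<close> is the
  subword of the small letters: the positions of the large letters must be permuted among
  themselves by an involution.\<close>

definition tails :: "nat \<Rightarrow> nat \<Rightarrow> nat list \<Rightarrow> nat list set" where
  "tails L m u = {w. length w = L \<and> filter (\<lambda>x. x \<le> m) w = u
      \<and> filter (\<lambda>x. m < x) w \<in> inv_words (large_positions m w)}"

lemma finite_large_positions [simp]: "finite (large_positions m w)"
  by (simp add: large_positions_def)

lemma upt_split: "m \<le> n \<Longrightarrow> [1..<Suc n] = [1..<Suc m] @ [Suc m..<Suc n]"
  using upt_add_eq_append[of 1 "Suc m" "n - m"] by (simp del: upt_Suc)

lemma filter_upt_eq_sorted_list:
  "filter Q [a..<b] = sorted_list_of_set {i \<in> {a..<b}. Q i}"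
proof -
  have "sorted_list_of_set (set (filter Q [a..<b])) = filter Q [a..<b]"
    by (rule sorted_list_of_set.idem_if_sorted_distinct) (simp_all add: sorted_wrt_filter)
  moreover have "set (filter Q [a..<b]) = {i \<in> {a..<b}. Q i}" by auto
  ultimately show ?thesis by simp
qed

lemma filter_map_upt:
  "filter Q (map p [a..<b]) = map p (sorted_list_of_set {i \<in> {a..<b}. Q (p i)})"
  by (simp add: filter_map filter_upt_eq_sorted_list comp_def)

lemma tail_eq_map:
  assumes "length w = L"
  shows "w = map (\<lambda>i. w ! (i - Suc m)) [Suc m..<Suc (m + L)]"
  by (rule nth_equalityI) (use assms in \<open>auto simp del: upt_Suc\<close>)

lemma large_positions_map:
  assumes "m \<le> n"
  shows "large_positions m (map p [Suc m..<Suc n]) = {i \<in> {Suc m..<Suc n}. m < p i}"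
  using assms by (auto simp: large_positions_def simp del: upt_Suc)

lemma filter_small_perms:
  assumes "\<pi> \<in> perms n" "m \<le> n"
  shows "filter (\<lambda>i. i \<le> m) \<pi> \<in> perms m"
  using perms_set[OF assms(1)] perms_distinct[OF assms(1)] assms(2)
  by (auto simp: perms_def permutations_of_set_def)

lemma values_upto_eq_filter:
  assumes "\<pi> \<in> perms n" "m \<le> n"
  shows "values_upto m \<pi> = filter (\<lambda>i. i \<le> m) \<pi>"
  using std_perms[OF filter_small_perms[OF assms]] by (simp add: values_upto_def)

text \<open>The letters up to \<open>m\<close> read from left to right spell \<open>\<sigma>\<close>. Those in the first \<open>m\<close> positions occupy
  \<open>A\<close> and are a rearrangement of \<open>A\<close>, so they are the first \<open>card A\<close> letters of \<open>\<sigma>\<close> and the others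
  lie in the tail.\<close>

lemma involution_decompose:
  assumes \<sigma>: "\<sigma> \<in> perms m" and mn: "m \<le> n" and \<pi>: "\<pi> \<in> involutions_over n \<sigma>"
    and p_def: "p = (\<lambda>i. \<pi> ! (i - 1))" and A_def: "A = {i \<in> {1..<Suc m}. p i \<le> m}"
  shows "invol_on {1..n} p" "\<pi> = map p [1..<Suc n]" "drop m \<pi> = map p [Suc m..<Suc n]"
    and "take (card A) \<sigma> \<in> inv_words A" "take (card A) \<sigma> = map p (sorted_list_of_set A)"
    and "card A \<in> J \<sigma>" "drop m \<pi> \<in> tails (n - m) m (drop (card A) \<sigma>)"
proof -
  have inv: "\<pi> \<in> involutions n" and v: "values_upto m \<pi> = \<sigma>"
    using \<pi> perms_length[OF \<sigma>] by (auto simp: involutions_over_def)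
  show p: "invol_on {1..n} p" and pm: "\<pi> = map p [1..<Suc n]"
    using involutions_invol_on[OF inv] by (simp_all add: p_def)
  have upt: "[1..<Suc n] = [1..<Suc m] @ [Suc m..<Suc n]"
    by (rule upt_split[OF mn])
  show w: "drop m \<pi> = map p [Suc m..<Suc n]"
    unfolding pm upt by (simp del: upt_Suc)
  have "filter (\<lambda>i. i \<le> m) \<pi> = \<sigma>"
    using values_upto_eq_filter[OF involutions_perms[OF inv] mn] v by simp
  moreover have "filter (\<lambda>i. i \<le> m) \<pi>
      = filter (\<lambda>i. i \<le> m) (map p [1..<Suc m]) @ filter (\<lambda>i. i \<le> m) (drop m \<pi>)"
    unfolding w by (subst pm) (simp only: upt map_append filter_append)
  ultimately have split: "\<sigma> = map p (sorted_list_of_set A) @ filter (\<lambda>i. i \<le> m) (drop m \<pi>)"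
    unfolding A_def by (simp only: filter_map_upt)
  have finA: "finite A" by (simp add: A_def)
  show t: "take (card A) \<sigma> = map p (sorted_list_of_set A)"
    by (subst split) simp
  have d: "drop (card A) \<sigma> = filter (\<lambda>i. i \<le> m) (drop m \<pi>)"
    by (subst split) simp
  have "invol_on A p"
    using p mn unfolding invol_on_def A_def by force
  then show tw: "take (card A) \<sigma> \<in> inv_words A"
    using inv_words_iff[OF finA] t by blast
  have "card A \<le> length \<sigma>" by (subst split) simp
  then show "card A \<in> J \<sigma>" using tw by (simp add: J_def pos_upto_def inv_words_def)
  let ?R = "large_positions m (drop m \<pi>)"
  have R: "?R = {i \<in> {Suc m..<Suc n}. m < p i}" unfolding w by (rule large_positions_map[OF mn])
  have "invol_on ?R p"
    unfolding R invol_on_def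
  proof
    fix i assume i: "i \<in> {i \<in> {Suc m..<Suc n}. m < p i}"
    then have "p i \<in> {1..n}" "p (p i) = i" using p by (auto simp: invol_on_def)
    then show "p i \<in> {i \<in> {Suc m..<Suc n}. m < p i} \<and> p (p i) = i" using i by simp
  qed
  moreover have "filter (\<lambda>x. m < x) (drop m \<pi>) = map p (sorted_list_of_set ?R)"
    unfolding R unfolding w by (rule filter_map_upt)
  ultimately have "filter (\<lambda>x. m < x) (drop m \<pi>) \<in> inv_words ?R"
    using inv_words_iff[of ?R] by auto
  then show "drop m \<pi> \<in> tails (n - m) m (drop (card A) \<sigma>)"
    using d perms_length[OF involutions_perms[OF inv]] by (simp add: tails_def)
qed

text \<open>The four sets \<open>A\<close>, \<open>U\<close>, \<open>P\<close>, \<open>R\<close> partition \<open>{1..n}\<close>. The prefix of \<open>\<sigma>\<close> prescribes an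
  involution of \<open>A\<close>, the large letters of the tail one of \<open>R\<close>, and the small letters of the tail
  a bijection from \<open>P\<close> to \<open>U\<close>, which is completed by its inverse.\<close>

lemma involution_from_tail:
  assumes \<sigma>: "\<sigma> \<in> perms m" and mn: "m \<le> n" and j: "j \<in> J \<sigma>"
    and w: "w \<in> tails (n - m) m (drop j \<sigma>)"
  shows "\<exists>\<pi>\<in>involutions_over n \<sigma>. drop m \<pi> = w"
proof -
  define g where "g i = w ! (i - Suc m)" for i
  have len: "length w = n - m" and small: "filter (\<lambda>x. x \<le> m) w = drop j \<sigma>"
    and large: "filter (\<lambda>x. m < x) w \<in> inv_words (large_positions m w)"
    using w by (auto simp: tails_def)
  have wg: "w = map g [Suc m..<Suc n]"
    using tail_eq_map[OF len, of m] mn by (simp add: g_def[abs_def] del: upt_Suc)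
  define A where "A = set (take j \<sigma>)"
  define U where "U = set (drop j \<sigma>)"
  define P where "P = {i \<in> {Suc m..<Suc n}. g i \<le> m}"
  define R where "R = {i \<in> {Suc m..<Suc n}. m < g i}"
  have finA: "finite A" and finR: "finite R" and finP: "finite P"
    by (simp_all add: A_def R_def P_def)
  have d\<sigma>: "distinct \<sigma>" and s\<sigma>: "set \<sigma> = {1..m}"
    using perms_distinct[OF \<sigma>] perms_set[OF \<sigma>] by auto
  have AU: "A \<union> U = {1..m}" "A \<inter> U = {}"
    using s\<sigma> set_append[of "take j \<sigma>" "drop j \<sigma>"] set_take_disj_set_drop_if_distinct[OF d\<sigma>, of j j]
    by (auto simp: A_def U_def)
  have jl: "j \<le> length \<sigma>" and jinv: "std (take j \<sigma>) \<in> involutions j"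
    using j by (auto simp: J_def pos_upto_def)
  have "card A = j" using distinct_card[OF distinct_take[OF d\<sigma>], of j] jl by (simp add: A_def)
  then have "take j \<sigma> \<in> inv_words A"
    using jinv d\<sigma> by (simp add: inv_words_def permutations_of_set_def A_def)
  then obtain r where r: "invol_on A r" "take j \<sigma> = map r (sorted_list_of_set A)"
    using inv_words_iff[OF finA] by blast
  have Rl: "large_positions m w = R"
    unfolding R_def by (subst wg, rule large_positions_map[OF mn])
  have large_g: "filter (\<lambda>x. m < x) w = map g (sorted_list_of_set R)"
    unfolding R_def by (subst wg, rule filter_map_upt)
  have small_g: "drop j \<sigma> = map g (sorted_list_of_set P)"
    unfolding P_def small[symmetric] by (subst wg, rule filter_map_upt)
  obtain s where s: "invol_on R s" "map g (sorted_list_of_set R) = map s (sorted_list_of_set R)"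
    using large inv_words_iff[OF finR] unfolding Rl large_g by blast
  then have gs: "g i = s i" if "i \<in> R" for i using that finR by simp
  have gR: "invol_on R g" using s(1) gs unfolding invol_on_def by simp
  have "distinct (map g (sorted_list_of_set P))"
    using d\<sigma> by (simp add: small_g[symmetric])
  then have g_inj: "inj_on g P" using finP by (simp add: distinct_map)
  have g_img: "g ` P = U" using finP by (simp add: U_def small_g)
  \<comment> \<open>The three branches are \<open>P \<union> R\<close>, \<open>A\<close> and \<open>U\<close>.\<close>
  define p where "p x = (if m < x then g x else if x \<in> A then r x else inv_into P g x)" for x
  have pR: "p x \<in> R \<and> p (p x) = x" if "x \<in> R" for x
    using gR that by (auto simp: invol_on_def p_def R_def)
  have pA: "p x \<in> A \<and> p (p x) = x" if "x \<in> A" for x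
  proof -
    have "x \<le> m" "r x \<in> A" "r (r x) = x" "r x \<le> m"
      using that r(1) AU by (auto simp: invol_on_def)
    then show ?thesis using that by (simp add: p_def)
  qed
  have pU: "p x \<in> P \<and> p (p x) = x" if "x \<in> U" for x
  proof -
    have "p x = inv_into P g x" using that AU by (auto simp: p_def)
    then have "p x \<in> P" "g (p x) = x"
      using that g_img by (auto simp: inv_into_into f_inv_into_f)
    moreover have "p (p x) = g (p x)" using \<open>p x \<in> P\<close> by (simp add: p_def[of "p x"] P_def)
    ultimately show ?thesis by simp
  qed
  have pP: "p x \<in> U \<and> p (p x) = x" if "x \<in> P" for x
  proof -
    have px: "p x = g x" "g x \<in> U" using that g_img by (auto simp: p_def P_def)
    then have "p (g x) = inv_into P g (g x)" using AU by (auto simp: p_def)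
    then show ?thesis using px g_inj that by simp
  qed
  have n_split: "{1..n} = A \<union> U \<union> P \<union> R"
    unfolding AU P_def R_def using mn by (auto simp: not_le)
  have p: "invol_on {1..n} p"
    unfolding invol_on_def n_split using pR pA pU pP by blast
  define \<pi> where "\<pi> = map p [1..<Suc n]"
  have \<pi>: "\<pi> \<in> involutions n" unfolding \<pi>_def by (rule invol_on_involutions[OF p])
  have upt: "[1..<Suc n] = [1..<Suc m] @ [Suc m..<Suc n]"
    by (rule upt_split[OF mn])
  have tail: "map p [Suc m..<Suc n] = w"
    by (subst wg, rule map_cong) (auto simp: p_def)
  have drop: "drop m \<pi> = w"
    unfolding tail[symmetric] \<pi>_def upt by (simp del: upt_Suc)
  have "{i \<in> {1..<Suc m}. p i \<le> m} = A"
  proof (intro equalityI subsetI)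
    fix i assume i: "i \<in> {i \<in> {1..<Suc m}. p i \<le> m}"
    have "i \<notin> U" using pU[of i] i by (auto simp: P_def)
    with i AU show "i \<in> A" by (auto simp: less_Suc_eq_le)
  next
    fix i assume i: "i \<in> A"
    then have "i \<in> {1..m}" "p i \<in> {1..m}" using pA[OF i] AU by auto
    then show "i \<in> {i \<in> {1..<Suc m}. p i \<le> m}" by auto
  qed
  then have "filter (\<lambda>x. x \<le> m) (map p [1..<Suc m]) = map p (sorted_list_of_set A)"
    using filter_map_upt[of "\<lambda>x. x \<le> m" p 1 "Suc m"] by simp
  also have "\<dots> = take j \<sigma>"
    unfolding r(2)
  proof (rule map_cong[OF refl])
    fix x assume "x \<in> set (sorted_list_of_set A)"
    then have "x \<in> A" "x \<le> m" using AU finA by auto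
    then show "p x = r x" by (simp add: p_def)
  qed
  finally have "filter (\<lambda>x. x \<le> m) \<pi> = take j \<sigma> @ drop j \<sigma>"
    unfolding \<pi>_def upt map_append filter_append tail small by simp
  then have "values_upto m \<pi> = \<sigma>"
    using values_upto_eq_filter[OF involutions_perms[OF \<pi>] mn] by simp
  then have "\<pi> \<in> involutions_over n \<sigma>"
    using \<pi> perms_length[OF \<sigma>] by (simp add: involutions_over_def)
  with drop show ?thesis by blast
qed

text \<open>The tail determines the involution: it shows \<open>card A\<close> through the number of its small letters,
  hence the values on \<open>A\<close> are read off from \<open>\<sigma>\<close>, and every other position up to \<open>m\<close> carries the place
  at which it occurs in the tail.\<close>

theorem drop_bij_tails:
  assumes \<sigma>: "\<sigma> \<in> perms m" and mn: "m \<le> n"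
  shows "bij_betw (drop m) (involutions_over n \<sigma>) (\<Union>j\<in>J \<sigma>. tails (n - m) m (drop j \<sigma>))"
proof (rule bij_betw_imageI)
  show "inj_on (drop m) (involutions_over n \<sigma>)"
  proof (rule inj_onI)
    fix \<pi> \<rho> assume \<pi>: "\<pi> \<in> involutions_over n \<sigma>" and \<rho>: "\<rho> \<in> involutions_over n \<sigma>"
      and eq: "drop m \<pi> = drop m \<rho>"
    define p r where "p = (\<lambda>i. \<pi> ! (i - 1))" and "r = (\<lambda>i. \<rho> ! (i - 1))"
    define A B where "A = {i \<in> {1..<Suc m}. p i \<le> m}" and "B = {i \<in> {1..<Suc m}. r i \<le> m}"
    note P = involution_decompose[OF \<sigma> mn \<pi> p_def A_def]
    note R = involution_decompose[OF \<sigma> mn \<rho> r_def B_def]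
    have agree: "p i = r i" if "m < i" "i \<le> n" for i
    proof -
      have "map p [Suc m..<Suc n] = map r [Suc m..<Suc n]" using P(3) R(3) eq by simp
      moreover have "i \<in> set [Suc m..<Suc n]" using that by auto
      ultimately show ?thesis unfolding map_eq_conv by blast
    qed
    have "drop (card A) \<sigma> = drop (card B) \<sigma>" using P(7) R(7) eq by (simp add: tails_def)
    then have "length \<sigma> - card A = length \<sigma> - card B" by (metis length_drop)
    moreover have "card A \<le> length \<sigma>" "card B \<le> length \<sigma>"
      using P(6) R(6) by (simp_all add: J_def)
    ultimately have card: "card A = card B" by linarith
    have AB: "A = B"
      using P(4) R(4) card by (auto simp: inv_words_def dest!: permutations_of_setD(1))
    have "finite A" by (simp add: A_def)
    have agreeA: "p i = r i" if "i \<in> A" for i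
      using P(5) R(5) that \<open>finite A\<close> unfolding card[symmetric] AB[symmetric] by simp
    have "p i = r i" if i: "i \<in> {1..n}" for i
    proof (cases "m < i \<or> i \<in> A")
      case True
      then show ?thesis using agree agreeA i by auto
    next
      case False
      then have "m < p i" using i by (auto simp: A_def)
      moreover have pi: "p i \<in> {1..n}" "p (p i) = i" using P(1) i by (auto simp: invol_on_def)
      ultimately have "r (p i) = i" using agree by auto
      moreover have "r (r (p i)) = p i" using R(1) pi(1) by (simp add: invol_on_def)
      ultimately show ?thesis by simp
    qed
    then show "\<pi> = \<rho>" unfolding P(2) R(2) by (auto simp del: upt_Suc)
  qed
  show "drop m ` involutions_over n \<sigma> = (\<Union>j\<in>J \<sigma>. tails (n - m) m (drop j \<sigma>))"
  proof (intro equalityI subsetI)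
    fix w assume "w \<in> drop m ` involutions_over n \<sigma>"
    then obtain \<pi> where \<pi>: "\<pi> \<in> involutions_over n \<sigma>" "w = drop m \<pi>" by blast
    from involution_decompose(6,7)[OF \<sigma> mn \<pi>(1) refl refl] \<pi>(2)
    show "w \<in> (\<Union>j\<in>J \<sigma>. tails (n - m) m (drop j \<sigma>))" by blast
  next
    fix w assume "w \<in> (\<Union>j\<in>J \<sigma>. tails (n - m) m (drop j \<sigma>))"
    then show "w \<in> drop m ` involutions_over n \<sigma>"
      using involution_from_tail[OF \<sigma> mn] by blast
  qed
qed

text \<open>Closes the gaps between the large letters without moving the small ones.\<close>

definition relabel :: "nat \<Rightarrow> nat set \<Rightarrow> nat \<Rightarrow> nat" where
  "relabel m R x = (if x \<le> m then x else m + rank R x)"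

lemma filter_map_invariant:
  assumes "\<And>x. x \<in> set w \<Longrightarrow> Q (f x) \<longleftrightarrow> Q x"
  shows "filter Q (map f w) = map f (filter Q w)"
  using assms by (induction w) auto

lemma large_positions_cong:
  assumes "\<And>x. x \<in> set w \<Longrightarrow> m < f x \<longleftrightarrow> m < x"
  shows "large_positions m (map f w) = large_positions m w"
  using assms by (auto simp: large_positions_def)

lemma card_large_positions: "card (large_positions m w) = length (filter (\<lambda>x. m < x) w)"
proof -
  define g where "g i = w ! (i - Suc m)" for i
  have wg: "w = map g [Suc m..<Suc (m + length w)]"
    using tail_eq_map[of w "length w" m] by (simp add: g_def[abs_def] del: upt_Suc)
  have "filter (\<lambda>x. m < x) w = map g (sorted_list_of_set {i \<in> {Suc m..<Suc (m + length w)}. m < g i})"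
    by (subst wg, rule filter_map_upt)
  moreover have "{i \<in> {Suc m..<Suc (m + length w)}. m < g i} = large_positions m w"
    by (auto simp: large_positions_def g_def)
  ultimately show ?thesis by simp
qed

definition inv_maj_sum :: "real \<Rightarrow> nat \<Rightarrow> real" where
  "inv_maj_sum q k = (\<Sum>\<tau>\<in>involutions k. q ^ maj \<tau>)"

text \<open>The large letters of a tail are exactly its large positions, and relabelling does not change
  which positions are large. Hence the relabelled word still knows its alphabet, and the
  relabelling can be undone.\<close>

lemma relabel_bij:
  assumes u: "\<forall>x\<in>set u. x \<le> m" and L: "L = length u + k"
  shows "bij_betw (\<lambda>w. map (relabel m (large_positions m w)) w) (tails L m u)
           (\<Union>\<tau>\<in>involutions k. shuffle_at m u (map ((+) m) \<tau>))" (is "bij_betw ?\<psi> _ ?S")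
    and "\<And>w. w \<in> tails L m u \<Longrightarrow> maj (map (relabel m (large_positions m w)) w) = maj w"
proof -
  have relab: "strict_mono_on (set w) (relabel m (large_positions m w))"
    "inj_on (relabel m (large_positions m w)) ({..m} \<union> large_positions m w)"
    "set w \<subseteq> {..m} \<union> large_positions m w"
    "\<And>x. x \<in> set w \<Longrightarrow> m < relabel m (large_positions m w) x \<longleftrightarrow> m < x"
    "set (filter (\<lambda>x. m < x) w) = large_positions m w"
    "card (large_positions m w) = k"
    if w: "w \<in> tails L m u" for w
  proof -
    let ?R = "large_positions m w"
    show fR: "set (filter (\<lambda>x. m < x) w) = ?R"
      by (rule permutations_of_setD(1)) (use w in \<open>simp add: tails_def inv_words_def\<close>)
    show sub: "set w \<subseteq> {..m} \<union> ?R"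
      unfolding fR[symmetric] by auto
    have rp: "0 < rank ?R x \<and> m < x" if "x \<in> ?R" for x
    proof -
      have "rank ?R x \<in> {1..card ?R}"
        using bij_betwE[OF rank_bij[OF finite_large_positions]] that by blast
      moreover have "x \<in> set (filter (\<lambda>x. m < x) w)" using that by (simp only: fR)
      ultimately show ?thesis by simp
    qed
    have sm: "strict_mono_on ({..m} \<union> ?R) (relabel m ?R)"
    proof (rule strict_mono_onI)
      fix x y assume "x \<in> {..m} \<union> ?R" "y \<in> {..m} \<union> ?R" "x < y"
      then show "relabel m ?R x < relabel m ?R y"
        using rp[of x] rp[of y]
          strict_mono_onD[OF rank_strict_mono[OF finite_large_positions[of m w]], of x y]
        by (cases "x \<le> m"; cases "y \<le> m") (simp_all add: relabel_def)
    qed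
    then show "inj_on (relabel m ?R) ({..m} \<union> ?R)" by (rule strict_mono_on_imp_inj_on)
    show "strict_mono_on (set w) (relabel m ?R)"
      using sm sub unfolding strict_mono_on_def by blast
    show "m < relabel m ?R x \<longleftrightarrow> m < x" if "x \<in> set w" for x
      using sub that rp[of x] by (auto simp: relabel_def)
    have "length w = length u + length (filter (\<lambda>x. m < x) w)"
      using sum_length_filter_compl[of "\<lambda>x. x \<le> m" w] w by (simp add: tails_def not_le)
    then show "card ?R = k" using w by (simp add: card_large_positions tails_def L)
  qed
  show "maj (?\<psi> w) = maj w" if "w \<in> tails L m u" for w
    using maj_map[OF relab(1)[OF that]] .
  show "bij_betw ?\<psi> (tails L m u) ?S"
  proof (rule bij_betw_imageI)
    show "inj_on ?\<psi> (tails L m u)"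
    proof (rule inj_onI)
      fix w w' assume w: "w \<in> tails L m u" and w': "w' \<in> tails L m u" and eq: "?\<psi> w = ?\<psi> w'"
      have "large_positions m (?\<psi> w) = large_positions m w"
        by (rule large_positions_cong) (rule relab(4)[OF w])
      moreover have "large_positions m (?\<psi> w') = large_positions m w'"
        by (rule large_positions_cong) (rule relab(4)[OF w'])
      ultimately have R: "large_positions m w = large_positions m w'" using eq by simp
      have "inj_on (relabel m (large_positions m w)) (set w \<union> set w')"
        by (rule inj_on_subset[OF relab(2)[OF w]])
          (use relab(3)[OF w] relab(3)[OF w'] R in simp)
      then show "w = w'" using eq unfolding R[symmetric] by (simp add: inj_on_map_eq_map)
    qed
    show "?\<psi> ` tails L m u = ?S"
    proof (intro equalityI subsetI)
      fix v assume "v \<in> ?\<psi> ` tails L m u"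
      then obtain w where w: "w \<in> tails L m u" and v: "v = ?\<psi> w" by blast
      let ?R = "large_positions m w"
      have small: "filter (\<lambda>x. x \<le> m) w = u" using w by (simp add: tails_def)
      have "filter (\<lambda>x. x \<le> m) v = map (relabel m ?R) (filter (\<lambda>x. x \<le> m) w)"
        unfolding v by (rule filter_map_invariant) (simp only: not_less[symmetric] relab(4)[OF w])
      also have "\<dots> = u"
        unfolding small by (rule map_idI) (use u in \<open>auto simp: relabel_def\<close>)
      finally have su: "filter (\<lambda>x. x \<le> m) v = u" .
      have "filter (\<lambda>x. m < x) v = map (relabel m ?R) (filter (\<lambda>x. m < x) w)"
        unfolding v by (rule filter_map_invariant) (rule relab(4)[OF w])
      also have "\<dots> = map ((+) m) (std (filter (\<lambda>x. m < x) w))"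
        unfolding std_eq_map_rank relab(5)[OF w] by (auto simp: relabel_def)
      finally have "filter (\<lambda>x. m < x) v = map ((+) m) (std (filter (\<lambda>x. m < x) w))" .
      moreover have "std (filter (\<lambda>x. m < x) w) \<in> involutions k"
        using w relab(6)[OF w] by (simp add: tails_def inv_words_def)
      ultimately show "v \<in> ?S" using su by (auto simp: shuffle_at_def)
    next
      fix v assume "v \<in> ?S"
      then obtain \<tau> where \<tau>: "\<tau> \<in> involutions k" and su: "filter (\<lambda>x. x \<le> m) v = u"
        and st: "filter (\<lambda>x. m < x) v = map ((+) m) \<tau>" and vs: "v \<in> shuffle_at m u (map ((+) m) \<tau>)"
        by (auto simp: shuffle_at_def)
      have lt: "length \<tau> = k" using perms_length[OF involutions_perms[OF \<tau>]] .
      have set\<tau>: "set \<tau> = {1..k}" using perms_set[OF involutions_perms[OF \<tau>]] .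
      define R where "R = large_positions m v"
      have cR: "card R = k" unfolding R_def card_large_positions st by (simp add: lt)
      have finR: "finite R" by (simp add: R_def)
      have Rm: "m < x" if "x \<in> R" for x using that by (simp add: R_def large_positions_def)
      obtain x where x: "x \<in> inv_words R" "std x = \<tau>"
      proof -
        have "\<tau> \<in> std ` inv_words R"
          using inv_words_std_bij[OF finR] \<tau> cR by (simp add: bij_betw_def)
        then show ?thesis using that by blast
      qed
      define h where "h y = (if y \<le> m then y else inv_into R (rank R) (y - m))" for y
      have h: "h y \<in> R \<and> rank R (h y) = y - m" if "y \<in> set v" "m < y" for y
      proof -
        have "y \<in> set (filter (\<lambda>x. m < x) v)" using that by simp
        then have "y - m \<in> rank R ` R"
          using rank_bij[OF finR] unfolding st cR by (auto simp: set\<tau> bij_betw_def)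
        then show ?thesis using that by (simp add: h_def inv_into_into f_inv_into_f)
      qed
      have hm: "m < h y \<longleftrightarrow> m < y" if "y \<in> set v" for y
      proof (cases "m < y")
        case True
        then show ?thesis using h[OF that True] Rm[of "h y"] by simp
      next
        case False
        then show ?thesis by (simp add: h_def)
      qed
      define w where "w = map h v"
      have Rw: "large_positions m w = R" unfolding w_def R_def by (rule large_positions_cong) (rule hm)
      have "filter (\<lambda>x. x \<le> m) w = map h (filter (\<lambda>x. x \<le> m) v)"
        unfolding w_def by (rule filter_map_invariant) (simp only: not_less[symmetric] hm)
      also have "\<dots> = u" unfolding su by (rule map_idI) (use u in \<open>auto simp: h_def\<close>)
      finally have wu: "filter (\<lambda>x. x \<le> m) w = u" .
      have xR: "x \<in> permutations_of_set R" using x by (simp add: inv_words_def)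
      have "filter (\<lambda>x. m < x) w = map h (filter (\<lambda>x. m < x) v)"
        unfolding w_def by (rule filter_map_invariant) (rule hm)
      also have "\<dots> = map (inv_into R (rank R)) \<tau>"
        unfolding st using set\<tau> by (auto simp: h_def)
      also have "\<dots> = x"
        unfolding x(2)[symmetric] std_permutation[OF finR xR] map_map
        by (rule map_idI) (use rank_inj[OF finR] permutations_of_setD(1)[OF xR] in auto)
      finally have "filter (\<lambda>x. m < x) w \<in> inv_words (large_positions m w)" using x Rw by simp
      moreover have "length w = L"
        using shuffle_at_length[OF vs] by (simp add: w_def L lt)
      ultimately have wt: "w \<in> tails L m u" using wu by (simp add: tails_def)
      have "?\<psi> w = v"
        unfolding Rw unfolding w_def map_map
      proof (rule map_idI)
        fix y assume y: "y \<in> set v"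
        show "(relabel m R \<circ> h) y = y"
        proof (cases "m < y")
          case True
          then show ?thesis using h[OF y True] Rm[of "h y"] by (simp add: relabel_def)
        next
          case False
          then show ?thesis by (simp add: relabel_def h_def)
        qed
      qed
      with wt show "v \<in> ?\<psi> ` tails L m u" by blast
    qed
  qed
qed

lemma sum_maj_tails:
  assumes q: "q > 0" and u: "\<forall>x\<in>set u. x \<le> m" and L: "L = length u + k"
  shows "(\<Sum>w\<in>tails L m u. q ^ maj w) = q ^ maj u * qbinom q L (length u) * inv_maj_sum q k"
proof -
  have "(\<Sum>w\<in>tails L m u. q ^ maj w)
      = (\<Sum>w\<in>(\<Union>\<tau>\<in>involutions k. shuffle_at m u (map ((+) m) \<tau>)). q ^ maj w)"
    using relabel_bij(2)[OF u L] by (subst sum.reindex_bij_betw[OF relabel_bij(1)[OF u L], symmetric]) simp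
  also have "\<dots> = (\<Sum>\<tau>\<in>involutions k. \<Sum>w\<in>shuffle_at m u (map ((+) m) \<tau>). q ^ maj w)"
  proof (rule sum.UNION_disjoint)
    show "\<forall>\<tau>\<in>involutions k. \<forall>\<tau>'\<in>involutions k. \<tau> \<noteq> \<tau>' \<longrightarrow>
        shuffle_at m u (map ((+) m) \<tau>) \<inter> shuffle_at m u (map ((+) m) \<tau>') = {}"
      by (auto simp: shuffle_at_def inj_on_map_eq_map)
  qed simp_all
  also have "\<dots> = (\<Sum>\<tau>\<in>involutions k. q ^ maj \<tau> * (q ^ maj u * qbinom q L (length u)))"
  proof (rule sum.cong[OF refl])
    fix \<tau> assume \<tau>: "\<tau> \<in> involutions k"
    have p: "\<forall>y\<in>set (map ((+) m) \<tau>). m < y"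
      using perms_set[OF involutions_perms[OF \<tau>]] by auto
    have "maj (map ((+) m) \<tau>) = maj \<tau>" by (rule maj_map) (simp add: strict_mono_on_def)
    then show "(\<Sum>w\<in>shuffle_at m u (map ((+) m) \<tau>). q ^ maj w)
        = q ^ maj \<tau> * (q ^ maj u * qbinom q L (length u))"
      using sum_maj_shuffle[OF q u p] perms_length[OF involutions_perms[OF \<tau>]]
      by (simp add: L power_add)
  qed
  finally show ?thesis by (simp add: inv_maj_sum_def sum_distrib_right[symmetric])
qed

lemma J_bound: "j \<in> J \<sigma> \<Longrightarrow> j \<le> length \<sigma>" by (simp add: J_def)

lemma finite_J [simp]: "finite (J \<sigma>)"
  by (rule finite_subset[of _ "{..length \<sigma>}"]) (auto simp: J_def)

lemma finite_tails [simp]: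
  assumes "\<forall>x\<in>set u. x \<le> m"
  shows "finite (tails (length u + k) m u)"
  using relabel_bij(1)[OF assms refl, of k] by (simp add: bij_betw_finite)

text \<open>The tails for different \<open>j\<close> are disjoint because they contain different numbers of small letters.\<close>

theorem sum_maj_involutions_over:
  assumes q: "q > 0" and \<sigma>: "\<sigma> \<in> perms m" and n: "2 * m \<le> n"
  shows "(\<Sum>\<pi>\<in>involutions_over n \<sigma>. q ^ maj (pos_after m \<pi>))
    = (\<Sum>j\<in>J \<sigma>. q ^ maj (drop j \<sigma>) * qbinom q (n - m) (m - j) * inv_maj_sum q (n - 2 * m + j))"
proof -
  have ls: "length \<sigma> = m" by (rule perms_length[OF \<sigma>])
  have u: "\<forall>x\<in>set (drop j \<sigma>). x \<le> m" for j
    using perms_set[OF \<sigma>] set_drop_subset[of j \<sigma>] by auto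
  have L: "n - m = length (drop j \<sigma>) + (n - 2 * m + j)" if "j \<in> J \<sigma>" for j
    using J_bound[OF that] n ls by simp
  have "(\<Sum>\<pi>\<in>involutions_over n \<sigma>. q ^ maj (pos_after m \<pi>))
      = (\<Sum>\<pi>\<in>involutions_over n \<sigma>. q ^ maj (drop m \<pi>))"
    by (simp add: pos_after_def maj_std)
  also have "\<dots> = (\<Sum>w\<in>(\<Union>j\<in>J \<sigma>. tails (n - m) m (drop j \<sigma>)). q ^ maj w)"
    using n by (intro sum.reindex_bij_betw drop_bij_tails \<sigma>) simp
  also have "\<dots> = (\<Sum>j\<in>J \<sigma>. \<Sum>w\<in>tails (n - m) m (drop j \<sigma>). q ^ maj w)"
  proof (rule sum.UNION_disjoint)
    show "\<forall>j\<in>J \<sigma>. finite (tails (n - m) m (drop j \<sigma>))"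
      using L finite_tails[OF u] by metis
    have "drop i \<sigma> \<noteq> drop j \<sigma>" if "i \<in> J \<sigma>" "j \<in> J \<sigma>" "i \<noteq> j" for i j
    proof
      assume "drop i \<sigma> = drop j \<sigma>"
      then have "length \<sigma> - i = length \<sigma> - j" by (metis length_drop)
      then show False using J_bound[OF that(1)] J_bound[OF that(2)] that(3) by simp
    qed
    then show "\<forall>i\<in>J \<sigma>. \<forall>j\<in>J \<sigma>. i \<noteq> j \<longrightarrow>
        tails (n - m) m (drop i \<sigma>) \<inter> tails (n - m) m (drop j \<sigma>) = {}"
      by (auto simp: tails_def)
  qed simp
  also have "\<dots> = (\<Sum>j\<in>J \<sigma>. q ^ maj (drop j \<sigma>) * qbinom q (n - m) (m - j) * inv_maj_sum q (n - 2 * m + j))"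
    using sum_maj_tails[OF q u L] by (intro sum.cong) (simp_all add: ls)
  finally show ?thesis .
qed

theorem sum_maj_involutions:
  assumes q: "q > 0" and n: "2 * m \<le> n"
  shows "(\<Sum>\<pi>\<in>involutions n. q ^ maj (pos_after m \<pi>))
    = (\<Sum>j\<le>m. real (num_involutions j) * real (m choose j) * qfact q (m - j)
        * qbinom q (n - m) (m - j) * inv_maj_sum q (n - 2 * m + j))"
proof -
  have mn: "m \<le> n" using n by simp
  have un: "involutions n = (\<Union>\<sigma>\<in>perms m. involutions_over n \<sigma>)"
    using values_upto_eq_filter[OF involutions_perms mn] filter_small_perms[OF involutions_perms mn]
    by (auto simp: involutions_over_def perms_length)
  have fin: "finite (involutions_over n \<sigma>)" for \<sigma>
    by (rule finite_subset[OF _ finite_involutions[of n]]) (auto simp: involutions_over_def)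
  have disj: "involutions_over n \<sigma> \<inter> involutions_over n \<sigma>' = {}"
    if "\<sigma> \<in> perms m" "\<sigma>' \<in> perms m" "\<sigma> \<noteq> \<sigma>'" for \<sigma> \<sigma>'
    using that by (auto simp: involutions_over_def perms_length)
  let ?c = "\<lambda>j. qbinom q (n - m) (m - j) * inv_maj_sum q (n - 2 * m + j)"
  have "(\<Sum>\<pi>\<in>involutions n. q ^ maj (pos_after m \<pi>))
      = (\<Sum>\<sigma>\<in>perms m. \<Sum>\<pi>\<in>involutions_over n \<sigma>. q ^ maj (pos_after m \<pi>))"
    unfolding un using fin disj by (intro sum.UNION_disjoint) auto
  also have "\<dots> = (\<Sum>\<sigma>\<in>perms m. \<Sum>j\<in>J \<sigma>. q ^ maj (drop j \<sigma>) * ?c j)"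
    using sum_maj_involutions_over[OF q _ n] by (intro sum.cong) (simp_all add: mult.assoc)
  also have "\<dots> = (\<Sum>\<sigma>\<in>perms m. \<Sum>j\<le>m. if j \<in> J \<sigma> then q ^ maj (drop j \<sigma>) * ?c j else 0)"
  proof (rule sum.cong[OF refl])
    fix \<sigma> assume "\<sigma> \<in> perms m"
    then have "J \<sigma> = {j \<in> {..m}. j \<in> J \<sigma>}" using J_bound[of _ \<sigma>] perms_length[of \<sigma> m] by auto
    then show "(\<Sum>j\<in>J \<sigma>. q ^ maj (drop j \<sigma>) * ?c j)
        = (\<Sum>j\<le>m. if j \<in> J \<sigma> then q ^ maj (drop j \<sigma>) * ?c j else 0)"
      by (subst sum.inter_filter[symmetric]) simp_all
  qed
  also have "\<dots> = (\<Sum>j\<le>m. \<Sum>\<sigma>\<in>perms m. if j \<in> J \<sigma> then q ^ maj (drop j \<sigma>) * ?c j else 0)"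
    by (rule sum.swap)
  also have "\<dots> = (\<Sum>j\<le>m. (\<Sum>\<sigma>\<in>{\<sigma> \<in> perms m. j \<in> J \<sigma>}. q ^ maj (drop j \<sigma>)) * ?c j)"
    by (simp add: sum.inter_filter sum_distrib_right if_distrib[of "\<lambda>x. x * _"] cong: if_cong)
  also have "\<dots> = (\<Sum>j\<le>m. real (num_involutions j) * real (m choose j) * qfact q (m - j)
        * qbinom q (n - m) (m - j) * inv_maj_sum q (n - 2 * m + j))"
    by (intro sum.cong) (simp_all add: sum_maj_involutive_prefix[OF q] mult.assoc)
  finally show ?thesis .
qed

section \<open>Descents and ascents under one name\<close>

text \<open>For \<open>s = 1\<close> the descents, for \<open>s = -1\<close> the ascents of a word with distinct letters. Both are
  treated at once: descents serve for \<open>q < 1\<close>, ascents for \<open>q > 1\<close>.\<close>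

definition breaks :: "int \<Rightarrow> nat list \<Rightarrow> nat set" where
  "breaks s \<pi> = {i. 1 \<le> i \<and> i < length \<pi> \<and> s * int (\<pi> ! i) < s * int (\<pi> ! (i - 1))}"

definition signed_sum :: "int \<Rightarrow> real \<Rightarrow> nat \<Rightarrow> real" where
  "signed_sum s q k = (\<Sum>\<pi>\<in>involutions k. q ^ \<Sum>(breaks s \<pi>))"

lemma breaks_subset: "breaks s \<pi> \<subseteq> {1..<length \<pi>}"
  by (auto simp: breaks_def)

lemma finite_breaks [simp]: "finite (breaks s \<pi>)"
  using breaks_subset finite_subset by blast

lemma breaks_1: "breaks 1 \<pi> = descents \<pi>"
  by (auto simp: breaks_def descents_def)

text \<open>A sorted list is determined by its multiset of entries.\<close>

lemma antitone_unique:
  fixes h h' :: "nat \<Rightarrow> 'b::linorder"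
  assumes fin: "finite A"
    and h: "\<And>x y. x \<in> A \<Longrightarrow> y \<in> A \<Longrightarrow> x < y \<Longrightarrow> h y \<le> h x"
    and h': "\<And>x y. x \<in> A \<Longrightarrow> y \<in> A \<Longrightarrow> x < y \<Longrightarrow> h' y \<le> h' x"
    and count: "\<And>v. card {x \<in> A. h x = v} = card {x \<in> A. h' x = v}"
    and x: "x \<in> A"
  shows "h x = h' x"
proof -
  let ?l = "sorted_list_of_set A"
  have sorted: "sorted (rev (map g ?l))"
    if "\<And>x y. x \<in> A \<Longrightarrow> y \<in> A \<Longrightarrow> x < y \<Longrightarrow> g y \<le> g x" for g :: "nat \<Rightarrow> 'b"
  proof -
    have "sorted_wrt (\<lambda>x y. g y \<le> g x) ?l"
      by (rule sorted_wrt_mono_rel[OF _ strict_sorted_list_of_set]) (use that fin in auto)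
    then show ?thesis by (simp add: sorted_wrt_rev sorted_wrt_map)
  qed
  have cnt: "count (mset (map g ?l)) v = card {x \<in> A. g x = v}" for g :: "nat \<Rightarrow> 'b" and v
  proof -
    have "count (mset (map g ?l)) v = length (filter (\<lambda>x. g x = v) ?l)"
      by (simp add: count_mset filter_map comp_def eq_commute count_list_eq_length_filter del: mset_map)
    also have "\<dots> = card (set (filter (\<lambda>x. g x = v) ?l))"
      by (rule distinct_card[symmetric]) simp
    also have "set (filter (\<lambda>x. g x = v) ?l) = {x \<in> A. g x = v}" using fin by auto
    finally show ?thesis .
  qed
  have "mset (map h ?l) = mset (map h' ?l)"
    by (rule multiset_eqI) (simp only: cnt count)
  then have "mset (rev (map h ?l)) = mset (rev (map h' ?l))" by simp
  moreover have "sorted (rev (map h ?l))" by (rule sorted) (rule h)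
  moreover have "sorted (rev (map h' ?l))" by (rule sorted) (rule h')
  ultimately have "rev (map h ?l) = rev (map h' ?l)"
    using properties_for_sort[of "rev (map h ?l)" "rev (map h' ?l)"]
      properties_for_sort[of "rev (map h' ?l)" "rev (map h' ?l)"] by simp
  then show ?thesis using x fin by simp
qed

section \<open>Encoding involutions by symmetric matrices\<close>

text \<open>The levels decrease weakly along the word and drop exactly after each break, so the sum of all
  levels is the sum of all breaks.\<close>

definition level :: "int \<Rightarrow> nat list \<Rightarrow> nat \<Rightarrow> nat" where
  "level s \<pi> i = card {d \<in> breaks s \<pi>. i \<le> d}"

text \<open>The multiset of the pairs \<open>(f i, f (\<pi> i))\<close> with \<open>f = level s \<pi>\<close>, given by multiplicities.\<close>

definition level_matrix :: "int \<Rightarrow> nat list \<Rightarrow> nat \<times> nat \<Rightarrow> nat" where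
  "level_matrix s \<pi> = (\<lambda>(a, b). card {i \<in> {1..length \<pi>}.
     level s \<pi> i = a \<and> level s \<pi> (\<pi> ! (i - 1)) = b})"

lemma level_antimono: "i \<le> j \<Longrightarrow> level s \<pi> j \<le> level s \<pi> i"
  unfolding level_def by (rule card_mono) auto

lemma level_le: "level s \<pi> i \<le> length \<pi>"
proof -
  have "level s \<pi> i \<le> card {1..<length \<pi>}"
    unfolding level_def by (rule card_mono) (use breaks_subset in auto)
  then show ?thesis by simp
qed

lemma level_eq_monotone:
  assumes "1 \<le> i" "i < j" "j \<le> length \<pi>" "level s \<pi> i = level s \<pi> j" "distinct \<pi>" "s \<noteq> 0"
  shows "s * int (\<pi> ! (i - 1)) < s * int (\<pi> ! (j - 1))"
proof -
  have nobreak: "d \<notin> breaks s \<pi>" if "i \<le> d" "d < j" for d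
  proof
    assume d: "d \<in> breaks s \<pi>"
    have "d \<in> {d \<in> breaks s \<pi>. i \<le> d} - {d \<in> breaks s \<pi>. j \<le> d}" using d that by simp
    moreover have "{d \<in> breaks s \<pi>. j \<le> d} \<subseteq> {d \<in> breaks s \<pi>. i \<le> d}" using assms(2) by auto
    ultimately have "{d \<in> breaks s \<pi>. j \<le> d} \<subset> {d \<in> breaks s \<pi>. i \<le> d}" by blast
    then have "level s \<pi> j < level s \<pi> i" unfolding level_def by (intro psubset_card_mono) simp_all
    then show False using assms(4) by simp
  qed
  have step: "s * int (\<pi> ! (d - 1)) < s * int (\<pi> ! d)" if "i \<le> d" "d < j" for d
  proof -
    have "\<pi> ! (d - 1) \<noteq> \<pi> ! d"
      using that assms(1,3,5) nth_eq_iff_index_eq[OF assms(5), of "d - 1" d] by simp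
    then have "s * int (\<pi> ! (d - 1)) \<noteq> s * int (\<pi> ! d)" using assms(6) by simp
    moreover have "\<not> s * int (\<pi> ! d) < s * int (\<pi> ! (d - 1))"
      using nobreak[OF that] that assms(1,3) by (simp add: breaks_def)
    ultimately show ?thesis by linarith
  qed
  have "i < j' \<Longrightarrow> j' \<le> j \<Longrightarrow> s * int (\<pi> ! (i - 1)) < s * int (\<pi> ! (j' - 1))" for j'
  proof (induction j')
    case (Suc d)
    then show ?case using step[of d] by (cases "i = d") auto
  qed simp
  then show ?thesis using assms(2) by simp
qed

lemma card_level: "card {i \<in> {1..length \<pi>}. level s \<pi> i = a}
  = (\<Sum>b\<le>length \<pi>. level_matrix s \<pi> (a, b))"
proof -
  let ?S = "{i \<in> {1..length \<pi>}. level s \<pi> i = a}"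
  have "(\<Sum>b\<le>length \<pi>. card {i \<in> ?S. level s \<pi> (\<pi> ! (i - 1)) = b}) = card ?S"
    using sum.group[of ?S "{..length \<pi>}" "\<lambda>i. level s \<pi> (\<pi> ! (i - 1))" "\<lambda>_. 1::nat"]
    by (simp add: level_le image_subset_iff)
  then show ?thesis by (simp add: level_matrix_def conj_assoc)
qed

text \<open>The row sums of the matrix are the sizes of the level sets, which determines \<open>f\<close>, a
  monotone function. On one level set \<open>s * \<pi>\<close> is increasing, so \<open>f \<circ> \<pi>\<close> is monotone there and
  determined by the entries of the row. Finally \<open>\<pi>\<close> maps the positions with \<open>f (\<pi> i) = b\<close>
  onto the level set of \<open>b\<close>, and it is monotone there since it is the inverse of its
  restriction to that level set. A monotone bijection between two given sets is unique.\<close>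

lemma level_matrix_inj:
  assumes \<pi>: "\<pi> \<in> involutions k" and \<rho>: "\<rho> \<in> involutions k" and s: "s = 1 \<or> s = -1"
    and M: "level_matrix s \<pi> = level_matrix s \<rho>"
  shows "\<pi> = \<rho>"
proof -
  define p r where "p = (\<lambda>i. \<pi> ! (i - 1))" and "r = (\<lambda>i. \<rho> ! (i - 1))"
  have lp: "length \<pi> = k" "distinct \<pi>" and lr: "length \<rho> = k" "distinct \<rho>"
    using perms_length perms_distinct involutions_perms \<pi> \<rho> by blast+
  have p: "invol_on {1..k} p" "\<pi> = map p [1..<Suc k]"
    and r: "invol_on {1..k} r" "\<rho> = map r [1..<Suc k]"
    using involutions_invol_on[OF \<pi>] involutions_invol_on[OF \<rho>] by (simp_all add: p_def r_def)
  have s0: "s \<noteq> 0" using s by auto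
  have lev: "level s \<pi> i = level s \<rho> i" if i: "i \<in> {1..k}" for i
  proof (rule antitone_unique[where A = "{1..k}" and h = "level s \<pi>" and h' = "level s \<rho>"])
    show "card {x \<in> {1..k}. level s \<pi> x = v} = card {x \<in> {1..k}. level s \<rho> x = v}" for v
      using card_level[of \<pi> s v] card_level[of \<rho> s v] M lp lr by simp
  qed (use i in \<open>auto intro: level_antimono\<close>)
  let ?f = "level s \<pi>"
  have blockp: "s * int (p i) < s * int (p j)"
    if "i \<in> {1..k}" "j \<in> {1..k}" "?f i = ?f j" "i < j" for i j
    using level_eq_monotone[of i j \<pi> s] that lp s0 by (simp add: p_def)
  have blockr: "s * int (r i) < s * int (r j)"
    if "i \<in> {1..k}" "j \<in> {1..k}" "?f i = ?f j" "i < j" for i j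
    using level_eq_monotone[of i j \<rho> s] that lr s0 lev by (simp add: r_def)
  have pk: "p i \<in> {1..k}" "p (p i) = i" and rk: "r i \<in> {1..k}" "r (r i) = i" if "i \<in> {1..k}" for i
    using p(1) r(1) that by (auto simp: invol_on_def)
  have anti: "s * int (?f y) \<le> s * int (?f x)" if "s * int x < s * int y" for x y
    using s that level_antimono[of x y s \<pi>] level_antimono[of y x s \<pi>] by auto
  have fp: "?f (p i) = ?f (r i)" if i: "i \<in> {1..k}" for i
  proof -
    let ?A = "{x \<in> {1..k}. ?f x = ?f i}"
    have "s * int (?f (p i)) = s * int (?f (r i))"
    proof (rule antitone_unique[where A = ?A and h = "\<lambda>i. s * int (?f (p i))"
          and h' = "\<lambda>i. s * int (?f (r i))"])
      fix x y assume "x \<in> ?A" "y \<in> ?A" "x < y"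
      then show "s * int (?f (p y)) \<le> s * int (?f (p x))" "s * int (?f (r y)) \<le> s * int (?f (r x))"
        by (auto intro!: anti blockp blockr)
    next
      fix v
      show "card {x \<in> ?A. s * int (?f (p x)) = v} = card {x \<in> ?A. s * int (?f (r x)) = v}"
      proof (cases "\<exists>b. v = s * int b")
        case False
        then have "{x \<in> ?A. s * int (?f (p x)) = v} = {}" "{x \<in> ?A. s * int (?f (r x)) = v} = {}"
          by auto
        then show ?thesis by (simp only:)
      next
        case True
        then obtain b where b: "v = s * int b" by blast
        have "card {x \<in> ?A. s * int (?f (p x)) = v} = level_matrix s \<pi> (?f i, b)"
          using s0 lp by (simp add: b level_matrix_def p_def conj_assoc)
        also have "\<dots> = level_matrix s \<rho> (?f i, b)" by (simp only: M)
        also have "\<dots> = card {x \<in> {1..k}. level s \<rho> x = ?f i \<and> level s \<rho> (r x) = b}"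
          using lr by (simp add: level_matrix_def r_def)
        also have "{x \<in> {1..k}. level s \<rho> x = ?f i \<and> level s \<rho> (r x) = b}
            = {x \<in> ?A. s * int (?f (r x)) = v}"
          using s0 lev rk by (auto simp: b)
        finally show ?thesis .
      qed
    qed (use i in auto)
    then show ?thesis using s0 by simp
  qed
  have "p i = r i" if i: "i \<in> {1..k}" for i
  proof -
    let ?B = "{x \<in> {1..k}. ?f (p x) = ?f (p i)}"
    have mono: "- (s * int (g y)) \<le> - (s * int (g x))"
      if "\<And>i. i \<in> {1..k} \<Longrightarrow> g i \<in> {1..k} \<and> g (g i) = i"
        "\<And>i j. i \<in> {1..k} \<Longrightarrow> j \<in> {1..k} \<Longrightarrow> ?f i = ?f j \<Longrightarrow> i < j \<Longrightarrow> s * int (g i) < s * int (g j)"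
        "x \<in> {1..k}" "y \<in> {1..k}" "?f (g x) = ?f (g y)" "x < y" for g x y
    proof -
      note gx = that(1)[OF that(3)] and gy = that(1)[OF that(4)]
      show ?thesis
        using that(2)[of "g x" "g y"] that(2)[of "g y" "g x"] that(5,6) gx gy s
        by (cases "g x" "g y" rule: linorder_cases) auto
    qed
    have single: "card {x \<in> {1..k}. ?f (g x) = c \<and> - (s * int (g x)) = v}
        = (if \<exists>y\<in>{1..k}. ?f y = c \<and> - (s * int y) = v then 1 else 0)"
      if g: "\<And>i. i \<in> {1..k} \<Longrightarrow> g i \<in> {1..k} \<and> g (g i) = i" for g c v
    proof (cases "\<exists>y\<in>{1..k}. ?f y = c \<and> - (s * int y) = v")
      case True
      then obtain y where y: "y \<in> {1..k}" "?f y = c" "- (s * int y) = v" by blast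
      have "{x \<in> {1..k}. ?f (g x) = c \<and> - (s * int (g x)) = v} = {g y}"
      proof (intro equalityI subsetI)
        fix x assume x: "x \<in> {x \<in> {1..k}. ?f (g x) = c \<and> - (s * int (g x)) = v}"
        then have "- (s * int (g x)) = v" by blast
        then have "s * int (g x) = s * int y" using y(3) by linarith
        then have "g x = y" using s0 by simp
        then show "x \<in> {g y}" using g[of x] x by auto
      next
        fix x assume "x \<in> {g y}"
        then show "x \<in> {x \<in> {1..k}. ?f (g x) = c \<and> - (s * int (g x)) = v}"
          using g[OF y(1)] y by auto
      qed
      then show ?thesis using True by simp
    next
      case False
      then have "{x \<in> {1..k}. ?f (g x) = c \<and> - (s * int (g x)) = v} = {}" using g by blast
      then show ?thesis using False by (simp only: card.empty if_False)
    qed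
    have B: "?B = {x \<in> {1..k}. ?f (r x) = ?f (p i)}" using fp by auto
    have "- (s * int (p i)) = - (s * int (r i))"
    proof (rule antitone_unique[where A = ?B and h = "\<lambda>i. - (s * int (p i))"
          and h' = "\<lambda>i. - (s * int (r i))"])
      fix x y assume xy: "x \<in> ?B" "y \<in> ?B" "x < y"
      show "- (s * int (p y)) \<le> - (s * int (p x))"
        by (rule mono) (use xy pk blockp in auto)
      show "- (s * int (r y)) \<le> - (s * int (r x))"
        by (rule mono) (use xy rk blockr fp in auto)
    next
      fix v
      have "card {x \<in> ?B. - (s * int (p x)) = v}
          = card {x \<in> {1..k}. ?f (p x) = ?f (p i) \<and> - (s * int (p x)) = v}"
        by (simp add: conj_assoc)
      also have "\<dots> = card {x \<in> {1..k}. ?f (r x) = ?f (p i) \<and> - (s * int (r x)) = v}"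
        using single[of p] single[of r] pk rk by simp
      also have "\<dots> = card {x \<in> ?B. - (s * int (r x)) = v}"
        unfolding B by (simp add: conj_assoc)
      finally show "card {x \<in> ?B. - (s * int (p x)) = v} = card {x \<in> ?B. - (s * int (r x)) = v}" .
    qed (use i in auto)
    then show ?thesis using s0 by simp
  qed
  then show ?thesis unfolding p(2) r(2) by (auto simp del: upt_Suc)
qed

lemma sum_level:
  shows "(\<Sum>i=1..length \<pi>. level s \<pi> i) = \<Sum>(breaks s \<pi>)"
proof -
  have "(\<Sum>i=1..length \<pi>. level s \<pi> i) = (\<Sum>i=1..length \<pi>. \<Sum>d\<in>breaks s \<pi>. if i \<le> d then 1 else 0)"
    by (simp add: level_def sum.inter_filter[symmetric])
  also have "\<dots> = (\<Sum>d\<in>breaks s \<pi>. \<Sum>i=1..length \<pi>. if i \<le> d then 1 else 0)"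
    by (rule sum.swap)
  also have "\<dots> = (\<Sum>d\<in>breaks s \<pi>. d)"
  proof (rule sum.cong[OF refl])
    fix d assume "d \<in> breaks s \<pi>"
    then have "{i \<in> {1..length \<pi>}. i \<le> d} = {1..d}" using breaks_subset by fastforce
    then show "(\<Sum>i=1..length \<pi>. if i \<le> d then 1 else 0) = d"
      by (simp add: sum.inter_filter[symmetric])
  qed
  finally show ?thesis .
qed

lemma level_matrix_group:
  fixes h :: "nat \<times> nat \<Rightarrow> 'a::comm_semiring_1"
  shows "(\<Sum>i=1..length \<pi>. h (level s \<pi> i, level s \<pi> (\<pi> ! (i - 1))))
    = (\<Sum>x\<in>{..length \<pi>} \<times> {..length \<pi>}. of_nat (level_matrix s \<pi> x) * h x)"
proof -
  let ?g = "\<lambda>i. (level s \<pi> i, level s \<pi> (\<pi> ! (i - 1)))"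
  have "(\<Sum>i=1..length \<pi>. h (?g i))
      = (\<Sum>x\<in>{..length \<pi>} \<times> {..length \<pi>}. \<Sum>i\<in>{i \<in> {1..length \<pi>}. ?g i = x}. h (?g i))"
    by (rule sum.group[symmetric]) (auto simp: level_le)
  also have "\<dots> = (\<Sum>x\<in>{..length \<pi>} \<times> {..length \<pi>}. of_nat (level_matrix s \<pi> x) * h x)"
  proof (rule sum.cong[OF refl])
    fix x :: "nat \<times> nat"
    have "(\<Sum>i\<in>{i \<in> {1..length \<pi>}. ?g i = x}. h (?g i)) = (\<Sum>i\<in>{i \<in> {1..length \<pi>}. ?g i = x}. h x)"
      by (rule sum.cong) auto
    also have "\<dots> = of_nat (level_matrix s \<pi> x) * h x"
      by (cases x) (simp add: level_matrix_def)
    finally show "(\<Sum>i\<in>{i \<in> {1..length \<pi>}. ?g i = x}. h (?g i)) = of_nat (level_matrix s \<pi> x) * h x" .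
  qed
  finally show ?thesis .
qed

text \<open>Since \<open>\<pi>\<close> permutes the positions, rows and columns of the matrix contribute equally. Weighting an
  entry by \<open>a + b\<close> rather than by \<open>a\<close> gives a positive weight to every entry except \<open>(0, 0)\<close>,
  which makes the bound in \<open>signed_sum_bounded\<close> converge.\<close>

lemma double_sum_breaks:
  assumes \<pi>: "\<pi> \<in> involutions k"
  shows "2 * \<Sum>(breaks s \<pi>) = (\<Sum>x\<in>{..k} \<times> {..k}. level_matrix s \<pi> x * (fst x + snd x))"
proof -
  have l: "length \<pi> = k" using perms_length[OF involutions_perms[OF \<pi>]] .
  have bij: "bij_betw (\<lambda>i. \<pi> ! (i - 1)) {1..k} {1..k}"
    using invol_on_inj[OF involutions_invol_on(1)[OF \<pi>]] invol_on_image[OF involutions_invol_on(1)[OF \<pi>]]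
    by (simp add: bij_betw_def)
  have "(\<Sum>i=1..k. level s \<pi> (\<pi> ! (i - 1))) = (\<Sum>i=1..k. level s \<pi> i)"
    by (rule sum.reindex_bij_betw[OF bij])
  then have "2 * \<Sum>(breaks s \<pi>) = (\<Sum>i=1..k. level s \<pi> i + level s \<pi> (\<pi> ! (i - 1)))"
    using sum_level[of s \<pi>] by (simp add: l sum.distrib)
  also have "\<dots> = (\<Sum>x\<in>{..k} \<times> {..k}. level_matrix s \<pi> x * (fst x + snd x))"
    using level_matrix_group[of "\<lambda>x. fst x + snd x" s \<pi>] by (simp add: l)
  finally show ?thesis .
qed

lemma inverse_one_minus_le_exp:
  fixes w r :: real
  assumes "0 \<le> w" "w \<le> r" "r < 1"
  shows "(\<Sum>t\<le>k. w ^ t) \<le> exp (w / (1 - r))"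
proof -
  have "(\<Sum>t\<le>k. w ^ t) = (1 - w ^ Suc k) / (1 - w)"
    using assms sum_gp0[of w k] by simp
  also have "\<dots> \<le> 1 / (1 - w)" using assms by (intro divide_right_mono) auto
  also have "\<dots> = 1 + w / (1 - w)" using assms by (simp add: field_simps)
  also have "\<dots> \<le> 1 + w / (1 - r)" using assms by (intro add_left_mono divide_left_mono) auto
  also have "\<dots> \<le> exp (w / (1 - r))" by (rule exp_ge_add_one_self)
  finally show ?thesis .
qed

text \<open>The entry \<open>(0, 0)\<close> of the level matrix follows from the others, because all entries add up to \<open>k\<close>.
  So the sum over involutions is at most the sum over all fillings of the remaining cells with
  weight \<open>r ^ (a + b)\<close> per unit, where \<open>r\<close> is the square root of \<open>q\<close>. This sum is a product of
  geometric sums, bounded uniformly in \<open>k\<close>.\<close>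

theorem signed_sum_bounded:
  assumes s: "s = 1 \<or> s = -1" and q: "0 < q" "q < 1"
  shows "\<exists>B. \<forall>k. signed_sum s q k \<le> B"
proof -
  define r where "r = sqrt q"
  have r: "0 < r" "r < 1" "r ^ 2 = q" using q by (simp_all add: r_def)
  define w where "w = (\<lambda>x::nat \<times> nat. r ^ (fst x + snd x))"
  have "signed_sum s q k \<le> exp ((1 / (1 - r)) ^ 2 / (1 - r))" for k
  proof -
    define G where "G = {..k} \<times> {..k} - {(0::nat, 0::nat)}"
    have finG: "finite G" and G0: "insert (0, 0) G = {..k} \<times> {..k}" "(0, 0) \<notin> G"
      by (auto simp: G_def)
    define enc where "enc \<pi> = restrict (level_matrix s \<pi>) G" for \<pi>
    have len: "length \<pi> = k" if "\<pi> \<in> involutions k" for \<pi>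
      using perms_length[OF involutions_perms[OF that]] .
    have weight: "q ^ \<Sum>(breaks s \<pi>) = (\<Prod>x\<in>G. w x ^ enc \<pi> x)" if \<pi>: "\<pi> \<in> involutions k" for \<pi>
    proof -
      have "q ^ \<Sum>(breaks s \<pi>) = r ^ (2 * \<Sum>(breaks s \<pi>))"
        by (simp only: r(3)[symmetric] power_mult)
      also have "\<dots> = (\<Prod>x\<in>insert (0, 0) G. r ^ (level_matrix s \<pi> x * (fst x + snd x)))"
        unfolding double_sum_breaks[OF \<pi>] G0 by (rule power_sum)
      also have "\<dots> = (\<Prod>x\<in>G. w x ^ enc \<pi> x)"
        using finG G0(2) by (simp add: w_def enc_def power_mult[symmetric] mult.commute)
      finally show ?thesis .
    qed
    have inj: "inj_on enc (involutions k)"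
    proof (rule inj_onI)
      fix \<pi> \<rho> assume \<pi>: "\<pi> \<in> involutions k" and \<rho>: "\<rho> \<in> involutions k" and eq: "enc \<pi> = enc \<rho>"
      have onG: "level_matrix s \<pi> x = level_matrix s \<rho> x" if "x \<in> G" for x
        using fun_cong[OF eq, of x] that by (simp add: enc_def)
      have total: "level_matrix s \<tau> (0, 0) + (\<Sum>x\<in>G. level_matrix s \<tau> x) = k" if "\<tau> \<in> involutions k" for \<tau>
      proof -
        have "level_matrix s \<tau> (0, 0) + (\<Sum>x\<in>G. level_matrix s \<tau> x)
            = (\<Sum>x\<in>insert (0, 0) G. level_matrix s \<tau> x)"
          using finG G0(2) by simp
        also have "\<dots> = k"
          unfolding G0(1) using level_matrix_group[of "\<lambda>_. 1::nat" s \<tau>] len[OF that] by simp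
        finally show ?thesis .
      qed
      have outside: "level_matrix s \<tau> x = 0" if "\<tau> \<in> involutions k" "x \<notin> {..k} \<times> {..k}" for \<tau> x
      proof -
        obtain a b where x: "x = (a, b)" by (cases x)
        have "{i \<in> {1..length \<tau>}. level s \<tau> i = a \<and> level s \<tau> (\<tau> ! (i - 1)) = b} = {}"
          using level_le[of s \<tau>] that by (auto simp: x len)
        then show ?thesis by (simp add: level_matrix_def x del: Collect_empty_eq)
      qed
      have "level_matrix s \<pi> x = level_matrix s \<rho> x" for x
      proof -
        have "x = (0, 0) \<or> x \<in> G \<or> x \<notin> {..k} \<times> {..k}" using G0(1) by blast
        moreover have "(\<Sum>x\<in>G. level_matrix s \<pi> x) = (\<Sum>x\<in>G. level_matrix s \<rho> x)"
          by (rule sum.cong[OF refl]) (rule onG)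
        then have "level_matrix s \<pi> (0, 0) = level_matrix s \<rho> (0, 0)"
          using total[OF \<pi>] total[OF \<rho>] by linarith
        ultimately show ?thesis
          using onG[of x] outside[OF \<pi>, of x] outside[OF \<rho>, of x] by metis
      qed
      then show "\<pi> = \<rho>" using level_matrix_inj[OF \<pi> \<rho> s] by blast
    qed
    have img: "enc ` involutions k \<subseteq> Pi\<^sub>E G (\<lambda>_. {..k})"
    proof
      fix F assume "F \<in> enc ` involutions k"
      then obtain \<pi> where \<pi>: "\<pi> \<in> involutions k" "F = enc \<pi>" by blast
      have "level_matrix s \<pi> x \<le> card {1..length \<pi>}" for x
        by (cases x) (auto simp: level_matrix_def intro!: card_mono simp del: card_atLeastAtMost)
      then show "F \<in> Pi\<^sub>E G (\<lambda>_. {..k})" using len[OF \<pi>(1)] by (auto simp: \<pi>(2) enc_def)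
    qed
    have wr: "0 \<le> w x" "x \<in> G \<Longrightarrow> w x \<le> r" for x
    proof -
      show "0 \<le> w x" using r by (simp add: w_def)
      assume "x \<in> G"
      then have "1 \<le> fst x + snd x" by (cases x) (auto simp: G_def)
      then show "w x \<le> r" unfolding w_def using power_decreasing[of 1 "fst x + snd x" r] r by simp
    qed
    have "signed_sum s q k = (\<Sum>\<pi>\<in>involutions k. \<Prod>x\<in>G. w x ^ enc \<pi> x)"
      by (simp add: signed_sum_def weight)
    also have "\<dots> = (\<Sum>F\<in>enc ` involutions k. \<Prod>x\<in>G. w x ^ F x)"
      by (simp add: sum.reindex[OF inj])
    also have "\<dots> \<le> (\<Sum>F\<in>Pi\<^sub>E G (\<lambda>_. {..k}). \<Prod>x\<in>G. w x ^ F x)"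
      using img finG wr by (intro sum_mono2) (auto intro!: finite_PiE prod_nonneg)
    also have "\<dots> = (\<Prod>x\<in>G. \<Sum>t\<le>k. w x ^ t)"
      using finG by (simp add: prod_sum_PiE)
    also have "\<dots> \<le> (\<Prod>x\<in>G. exp (w x / (1 - r)))"
      using wr r by (intro prod_mono conjI inverse_one_minus_le_exp sum_nonneg) auto
    also have "\<dots> = exp ((\<Sum>x\<in>G. w x) / (1 - r))"
      using finG by (simp add: exp_sum sum_divide_distrib)
    also have "\<dots> \<le> exp ((1 / (1 - r)) ^ 2 / (1 - r))"
    proof -
      have "(\<Sum>x\<in>G. w x) \<le> (\<Sum>x\<in>{..k} \<times> {..k}. w x)"
        using wr by (intro sum_mono2) (auto simp: G_def)
      also have "\<dots> = (\<Sum>a\<le>k. r ^ a) * (\<Sum>b\<le>k. r ^ b)"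
        by (simp add: w_def sum_product sum.cartesian_product power_add case_prod_beta)
      also have "\<dots> \<le> (1 / (1 - r)) * (1 / (1 - r))"
      proof -
        have "(\<Sum>a\<le>k. r ^ a) = (1 - r ^ Suc k) / (1 - r)" using r sum_gp0[of r k] by simp
        also have "\<dots> \<le> 1 / (1 - r)" using r by (intro divide_right_mono) auto
        finally show ?thesis using r by (intro mult_mono sum_nonneg) auto
      qed
      finally have "(\<Sum>x\<in>G. w x) \<le> (1 / (1 - r)) ^ 2" by (simp add: power2_eq_square)
      then show ?thesis using r by (simp add: divide_right_mono)
    qed
    finally show ?thesis .
  qed
  then show ?thesis by blast
qed

section \<open>Extending an involution without changing its breaks\<close>

lemma append_fixed_point:
  assumes \<pi>: "\<pi> \<in> involutions k"
  shows "\<pi> @ [Suc k] \<in> involutions (Suc k)" "breaks 1 (\<pi> @ [Suc k]) = breaks 1 \<pi>"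
proof -
  have l: "length \<pi> = k" and set\<pi>: "set \<pi> = {1..k}" and d: "distinct \<pi>"
    using perms_length perms_set perms_distinct involutions_perms[OF \<pi>] by auto
  have inv: "invol_on {1..k} (\<lambda>i. \<pi> ! (i - 1))" by (rule involutions_invol_on(1)[OF \<pi>])
  have perm: "\<pi> @ [Suc k] \<in> perms (Suc k)"
    using set\<pi> d by (auto simp: perms_def permutations_of_set_def)
  have "(\<pi> @ [Suc k]) ! ((\<pi> @ [Suc k]) ! (i - 1) - 1) = i" if i: "i \<in> {1..Suc k}" for i
  proof (cases "i = Suc k")
    case True
    then show ?thesis using l by (simp add: nth_append)
  next
    case False
    then have "i \<in> {1..k}" using i by auto
    then have "\<pi> ! (i - 1) \<in> {1..k}" "\<pi> ! (\<pi> ! (i - 1) - 1) = i"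
      using inv by (auto simp: invol_on_def)
    moreover from this(1) have "\<pi> ! (i - 1) - 1 < k" by auto
    moreover have "i - 1 < k" using \<open>i \<in> {1..k}\<close> by auto
    ultimately show ?thesis using l by (simp add: nth_append)
  qed
  then show "\<pi> @ [Suc k] \<in> involutions (Suc k)" using perm by (simp add: involutions_def)
  have last: "\<pi> ! i \<le> k" if "i < k" for i using nth_mem[of i \<pi>] that l set\<pi> by simp
  show "breaks 1 (\<pi> @ [Suc k]) = breaks 1 \<pi>"
  proof (rule set_eqI)
    fix i
    show "i \<in> breaks 1 (\<pi> @ [Suc k]) \<longleftrightarrow> i \<in> breaks 1 \<pi>"
    proof (cases "i < k")
      case True
      then show ?thesis using l by (auto simp: breaks_def nth_append)
    next
      case False
      then show ?thesis using l last[of "i - 1"] by (auto simp: breaks_def nth_append)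
    qed
  qed
qed

text \<open>With no ascent at all the value is \<open>0\<close>, so that the letters after position \<open>last_ascent \<pi>\<close> always form
  the maximal decreasing suffix.\<close>

definition last_ascent :: "nat list \<Rightarrow> nat" where
  "last_ascent \<pi> = Max (insert 0 (breaks (-1) \<pi>))"

text \<open>The core consists of the positions in the decreasing suffix whose letter also lies beyond the last
  ascent. It is the initial part of the suffix, and the involution reverses it (\<open>core_reversed\<close>).\<close>

definition core_size :: "nat list \<Rightarrow> nat" where
  "core_size \<pi> = card {i \<in> {last_ascent \<pi><..length \<pi>}. last_ascent \<pi> < \<pi> ! (i - 1)}"

text \<open>Inserts the letter \<open>e + a + 1\<close> at position \<open>e + 1\<close>, where \<open>e\<close> is the last ascent and \<open>a\<close> the
  size of the core, and shifts the letters that are at least as large. The core becomes a reversed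
  block of size \<open>a + 1\<close>, so the result is again an involution; the suffix stays decreasing.\<close>

definition grow_core :: "nat list \<Rightarrow> nat \<Rightarrow> nat" where
  "grow_core \<pi> i = (let e = last_ascent \<pi> in
     if i \<le> e then (if e < \<pi> ! (i - 1) then Suc (\<pi> ! (i - 1)) else \<pi> ! (i - 1))
     else if i = Suc e then Suc (e + core_size \<pi>)
     else \<pi> ! (i - 2))"

text \<open>The letters in the suffix decrease, so those exceeding \<open>e\<close> come first, at the positions
  \<open>{e<..e + a}\<close>. The involution permutes this interval and is decreasing on it, so it is the reversal.\<close>

lemma core_reversed:
  assumes \<pi>: "\<pi> \<in> involutions k" and e_def: "e = last_ascent \<pi>" and a_def: "a = core_size \<pi>"
    and p_def: "p = (\<lambda>i. \<pi> ! (i - 1))"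
  shows "\<And>i j. e < i \<Longrightarrow> i < j \<Longrightarrow> j \<le> k \<Longrightarrow> p j < p i"
    and "\<And>i. e < i \<Longrightarrow> i \<le> k \<Longrightarrow> e < p i \<longleftrightarrow> i \<le> e + a"
    and "\<And>i. e < i \<Longrightarrow> i \<le> e + a \<Longrightarrow> p i + i = Suc (2 * e + a)"
    and "e + a \<le> k"
proof -
  have l: "length \<pi> = k" and d: "distinct \<pi>"
    using perms_length perms_distinct involutions_perms[OF \<pi>] by auto
  have pk: "p i \<in> {1..k}" "p (p i) = i" if "i \<in> {1..k}" for i
    using involutions_invol_on(1)[OF \<pi>] that by (auto simp: invol_on_def p_def)
  have "e \<in> insert 0 (breaks (-1) \<pi>)" unfolding e_def last_ascent_def by (rule Max_in) simp_all
  then have ek: "e \<le> k" using breaks_subset[of "-1" \<pi>] l by auto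
  have noasc: "\<pi> ! d < \<pi> ! (d - 1)" if "e < d" "d < k" for d
  proof -
    have "d \<notin> breaks (-1) \<pi>"
    proof
      assume "d \<in> breaks (-1) \<pi>"
      then have "d \<le> e" unfolding e_def last_ascent_def by (intro Max_ge) simp_all
      then show False using that by simp
    qed
    then have "\<not> \<pi> ! (d - 1) < \<pi> ! d" using that l by (simp add: breaks_def)
    moreover have "\<pi> ! (d - 1) \<noteq> \<pi> ! d"
      using nth_eq_iff_index_eq[OF d, of "d - 1" d] that l by simp
    ultimately show ?thesis by simp
  qed
  show dec: "p j < p i" if ij: "e < i" "i < j" "j \<le> k" for i j
    using ij(2,3)
  proof (induction j)
    case (Suc n)
    have "p (Suc n) < p n" using noasc[of n] Suc.prems ij(1) by (simp add: p_def)
    then show ?case using Suc by (cases "i = n") auto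
  qed simp
  define A where "A = {i \<in> {e<..k}. e < p i}"
  have a: "a = card A" using l by (simp add: a_def core_size_def A_def e_def p_def)
  have finA: "finite A" by (simp add: A_def)
  have down: "i \<in> A" if "j \<in> A" "e < i" "i \<le> j" for i j
    using dec[of i j] that by (cases "i = j") (auto simp: A_def)
  have A_le: "i \<le> e + a" if "i \<in> A" for i
  proof -
    have "card {e<..i} \<le> card A" by (rule card_mono[OF finA]) (use down[OF that] in auto)
    then show ?thesis by (simp add: a)
  qed
  have A_gt: "e + a < i" if "i \<notin> A" "e < i" "i \<le> k" for i
  proof -
    have "j < i" if "j \<in> A" for j
      using down[OF that \<open>e < i\<close>] \<open>i \<notin> A\<close> by (cases "i \<le> j") auto
    then have "card A \<le> card {e<..<i}" by (intro card_mono) (auto simp: A_def)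
    then show ?thesis using \<open>e < i\<close> by (simp add: a)
  qed
  have "card A \<le> card {e<..k}" by (rule card_mono) (auto simp: A_def)
  then show ak: "e + a \<le> k" using ek by (simp add: a)
  show iff: "e < p i \<longleftrightarrow> i \<le> e + a" if "e < i" "i \<le> k" for i
    using A_le[of i] A_gt[of i] that unfolding A_def by fastforce
  have A: "A = {e<..e + a}" using A_le iff ak by (auto simp: A_def)
  have pA: "p i \<in> A" if "i \<in> A" for i
    using pk[of i] that by (auto simp: A_def)
  show "p i + i = Suc (2 * e + a)" if i: "e < i" "i \<le> e + a" for i
  proof -
    have iA: "i \<in> A" using i A by auto
    \<comment> \<open>As the involution is decreasing on the core, the \<open>i - e - 1\<close> positions before \<open>i\<close> go exactly to
      the letters above \<open>p i\<close>.\<close>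
    have "p ` {e<..<i} = {p i<..e + a}"
    proof (intro equalityI subsetI)
      fix y assume "y \<in> p ` {e<..<i}"
      then obtain x where x: "y = p x" "e < x" "x < i" by auto
      then have "x \<in> A" using i A by auto
      then have "y \<in> A" "p i < y" using pA[of x] dec[of x i] x i ak by auto
      then show "y \<in> {p i<..e + a}" using A by auto
    next
      fix y assume y: "y \<in> {p i<..e + a}"
      have "p i \<in> A" by (rule pA[OF iA])
      then have "y \<in> A" using y A by auto
      then have py: "p y \<in> A" "p (p y) = y" using pA pk(2)[of y] by (auto simp: A_def)
      have "p y < i"
      proof (rule ccontr)
        assume "\<not> p y < i"
        then have "p (p y) \<le> p i"
          using dec[of i "p y"] py(1) i by (cases "p y = i") (auto simp: A_def)
        then show False using py(2) y by simp
      qed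
      then have "p y \<in> {e<..<i}" using py(1) by (auto simp: A_def)
      then show "y \<in> p ` {e<..<i}" using py(2) by (metis imageI)
    qed
    moreover have "inj_on p {e<..<i}"
    proof (rule inj_onI)
      fix x y assume "x \<in> {e<..<i}" "y \<in> {e<..<i}" "p x = p y"
      then show "x = y" using dec[of x y] dec[of y x] i ak by (cases x y rule: linorder_cases) auto
    qed
    ultimately have "card {e<..<i} = card {p i<..e + a}" by (metis card_image)
    moreover have "e < p i" "p i \<le> e + a" using pA[OF iA] A by auto
    ultimately show ?thesis using i by simp
  qed
qed

lemma grow_core_involution:
  assumes \<pi>: "\<pi> \<in> involutions k"
  defines "\<pi>' \<equiv> map (grow_core \<pi>) [1..<Suc (Suc k)]"
  shows "\<pi>' \<in> involutions (Suc k)" "breaks (-1) \<pi>' = breaks (-1) \<pi>"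
proof -
  define e a p where "e = last_ascent \<pi>" and "a = core_size \<pi>" and "p = (\<lambda>i. \<pi> ! (i - 1))"
  note core = core_reversed[OF \<pi> e_def a_def p_def]
  have l: "length \<pi> = k" using perms_length involutions_perms[OF \<pi>] by auto
  have pk: "p i \<in> {1..k}" "p (p i) = i" if "i \<in> {1..k}" for i
    using involutions_invol_on(1)[OF \<pi>] that by (auto simp: invol_on_def p_def)
  define g where "g = grow_core \<pi>"
  have g: "g i = (if i \<le> e then (if e < p i then Suc (p i) else p i)
      else if i = Suc e then Suc (e + a) else p (i - 1))" for i
    by (simp add: g_def grow_core_def Let_def e_def a_def p_def numeral_2_eq_2)
  \<comment> \<open>A letter above \<open>e\<close> at a position up to \<open>e\<close> lies beyond the core, as the core is mapped to itself.\<close>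
  have high: "e + a < p i" if "i \<in> {1..k}" "i \<le> e" "e < p i" for i
    using core(2)[of "p i"] pk[of i] that by auto
  have "g i \<in> {1..Suc k} \<and> g (g i) = i" if i: "i \<in> {1..Suc k}" for i
  proof -
    consider (low) "i \<le> e" "p i \<le> e" | (out) "i \<le> e" "e < p i" | (new) "i = Suc e"
      | (tail) "Suc e < i" "p (i - 1) \<le> e" | (core) "Suc e < i" "e < p (i - 1)"
      by linarith
    then show ?thesis
    proof cases
      case low
      then have "i \<in> {1..k}" using i core(4) by auto
      then show ?thesis using low pk[of i] by (auto simp: g)
    next
      case out
      then have ik: "i \<in> {1..k}" using i core(4) by auto
      then have "g i = Suc (p i)" using out by (simp add: g)
      moreover have "g (Suc (p i)) = p (p i)" using out by (simp add: g)
      ultimately show ?thesis using pk[OF ik] by auto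
    next
      case new
      then have gi: "g i = Suc (e + a)" by (simp add: g)
      have "g (Suc (e + a)) = Suc e"
      proof (cases "a = 0")
        case False
        then show ?thesis using core(3)[of "e + a"] by (simp add: g)
      qed (simp add: g)
      then show ?thesis using gi new core(4) by auto
    next
      case tail
      then have ik: "i - 1 \<in> {1..k}" using i by auto
      have "g i = p (i - 1)" using tail by (simp add: g)
      moreover have "g (p (i - 1)) = Suc (p (p (i - 1)))"
      proof -
        have "e < p (p (i - 1))" using tail pk(2)[OF ik] by simp
        then show ?thesis using tail by (simp add: g)
      qed
      ultimately show ?thesis using pk[OF ik] tail by auto
    next
      case core
      then have ik: "i - 1 \<in> {1..k}" "e < i - 1" "i - 1 \<le> k" using i by auto
      have ia: "i - 1 \<le> e + a" using core_reversed(2)[OF \<pi> e_def a_def p_def ik(2,3)] core by simp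
      have sum: "p (i - 1) + (i - 1) = Suc (2 * e + a)"
        by (rule core_reversed(3)[OF \<pi> e_def a_def p_def ik(2) ia])
      have gi: "g i = p (i - 1)" using core by (simp add: g)
      have "g (p (i - 1)) = i"
      proof (cases "p (i - 1) = Suc e")
        case True
        then show ?thesis using sum core by (simp add: g)
      next
        case False
        then have "e < p (i - 1) - 1" "p (i - 1) - 1 \<le> e + a" using core sum by auto
        from core_reversed(3)[OF \<pi> e_def a_def p_def this] sum core
        have "p (p (i - 1) - 1) = i" by linarith
        then show ?thesis using False core by (simp add: g)
      qed
      then show ?thesis using gi pk[OF ik(1)] by auto
    qed
  qed
  then have "invol_on {1..Suc k} g" by (simp add: invol_on_def)
  then show "\<pi>' \<in> involutions (Suc k)"
    using invol_on_involutions by (simp only: \<pi>'_def g_def)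
  have l': "length \<pi>' = Suc k" by (simp add: \<pi>'_def del: upt_Suc)
  have nth: "\<pi>' ! i = g (Suc i)" if "i < Suc k" for i
    using that by (simp add: \<pi>'_def g_def del: upt_Suc)
  have e_break: "0 < e \<Longrightarrow> e \<in> breaks (-1) \<pi>"
  proof -
    assume "0 < e"
    have "e \<in> insert 0 (breaks (-1) \<pi>)" unfolding e_def last_ascent_def by (rule Max_in) simp_all
    then show ?thesis using \<open>0 < e\<close> by simp
  qed
  have break_iff: "i \<in> breaks (-1) \<pi> \<longleftrightarrow> 1 \<le> i \<and> i < k \<and> p i < p (Suc i)" for i
    by (auto simp: breaks_def p_def l)
  have break'_iff: "i \<in> breaks (-1) \<pi>' \<longleftrightarrow> 1 \<le> i \<and> i < Suc k \<and> g i < g (Suc i)" for i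
    using nth[of i] nth[of "i - 1"] by (auto simp: breaks_def l')
  show "breaks (-1) \<pi>' = breaks (-1) \<pi>"
  proof (rule set_eqI)
    fix i
    consider (zero) "i = 0" | (before) "1 \<le> i" "i < e" | (at) "1 \<le> i" "i = e" | (new) "i = Suc e"
      | (after) "Suc e < i" by linarith
    then show "i \<in> breaks (-1) \<pi>' \<longleftrightarrow> i \<in> breaks (-1) \<pi>"
    proof cases
      case zero
      then show ?thesis by (simp add: break_iff break'_iff)
    next
      case before
      then have "g i < g (Suc i) \<longleftrightarrow> p i < p (Suc i)" by (auto simp: g)
      then show ?thesis using before core(4) by (auto simp: break_iff break'_iff)
    next
      case at
      then have e: "e \<in> breaks (-1) \<pi>" using e_break by simp
      then have ek: "e < k" "p e < p (Suc e)" by (auto simp: break_iff)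
      have "p e \<le> e"
      proof (rule ccontr)
        assume n: "\<not> p e \<le> e"
        then have "e + a < p e" using high[of e] at ek by auto
        then have "e + a < p (Suc e)" "e < p (Suc e)" using ek by auto
        then have "Suc e \<le> e + a" using core(2)[of "Suc e"] ek by simp
        then have "p (Suc e) + Suc e = Suc (2 * e + a)" using core(3)[of "Suc e"] by simp
        then show False using \<open>e + a < p (Suc e)\<close> by simp
      qed
      then have "g e < g (Suc e)" by (simp add: g)
      then show ?thesis using e at ek by (simp add: break'_iff)
    next
      case new
      have "i \<notin> breaks (-1) \<pi>" using core(1)[of i "Suc i"] new by (auto simp: break_iff)
      moreover have "\<not> g i < g (Suc i)" if "i < Suc k"
      proof -
        have "p (Suc e) \<le> e + a"
          using core(2)[of "Suc e"] core(3)[of "Suc e"] that new by (cases "e < p (Suc e)") auto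
        then show ?thesis using new by (simp add: g)
      qed
      ultimately show ?thesis by (auto simp: break'_iff)
    next
      case after
      have "i \<notin> breaks (-1) \<pi>" using core(1)[of i "Suc i"] after by (auto simp: break_iff)
      moreover have "\<not> g i < g (Suc i)" if "i < Suc k"
      proof -
        have "e < i - 1" "i - 1 < i" "i \<le> k" using after that by linarith+
        from core(1)[OF this] after show ?thesis by (simp add: g)
      qed
      ultimately show ?thesis by (auto simp: break'_iff)
    qed
  qed
qed

text \<open>The breaks, and with them the place of the insertion, are the same before and after.\<close>

lemma grow_core_inj:
  assumes \<pi>: "\<pi> \<in> involutions k" and \<rho>: "\<rho> \<in> involutions k"
    and eq: "map (grow_core \<pi>) [1..<Suc (Suc k)] = map (grow_core \<rho>) [1..<Suc (Suc k)]"
  shows "\<pi> = \<rho>"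
proof -
  define e p r where "e = last_ascent \<pi>" and "p = (\<lambda>i. \<pi> ! (i - 1))" and "r = (\<lambda>i. \<rho> ! (i - 1))"
  have "breaks (-1) \<pi> = breaks (-1) \<rho>"
    using grow_core_involution(2)[OF \<pi>] grow_core_involution(2)[OF \<rho>] unfolding eq by (rule subst)
  then have e': "e = last_ascent \<rho>" by (simp add: e_def last_ascent_def)
  have g: "grow_core \<pi> i = grow_core \<rho> i" if "1 \<le> i" "i \<le> Suc k" for i
  proof -
    have "i \<in> set [1..<Suc (Suc k)]" using that by auto
    then show ?thesis using eq unfolding map_eq_conv by blast
  qed
  have "p i = r i" if i: "1 \<le> i" "i \<le> k" for i
  proof (cases "i \<le> e")
    case True
    then show ?thesis using g[of i] i
      by (auto simp: grow_core_def Let_def e_def[symmetric] e'[symmetric] p_def r_def split: if_splits)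
  next
    case False
    then show ?thesis using g[of "Suc i"] i
      by (auto simp: grow_core_def Let_def e_def[symmetric] e'[symmetric] p_def r_def)
  qed
  then show "\<pi> = \<rho>"
    using involutions_invol_on(2)[OF \<pi>] involutions_invol_on(2)[OF \<rho>]
    unfolding p_def[symmetric] r_def[symmetric]
    by (metis (no_types, lifting) atLeastLessThan_iff less_Suc_eq_le map_cong set_upt)
qed

lemma signed_sum_mono:
  assumes s: "s = 1 \<or> s = -1" and q: "0 < q"
  shows "signed_sum s q k \<le> signed_sum s q (Suc k)"
proof -
  have "\<exists>\<phi>. inj_on \<phi> (involutions k) \<and> \<phi> ` involutions k \<subseteq> involutions (Suc k)
      \<and> (\<forall>\<pi>\<in>involutions k. breaks s (\<phi> \<pi>) = breaks s \<pi>)"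
    using s
  proof
    assume s: "s = 1"
    show ?thesis
      by (rule exI[of _ "\<lambda>\<pi>. \<pi> @ [Suc k]"]) (auto simp: s append_fixed_point inj_on_def)
  next
    assume s: "s = -1"
    let ?\<phi> = "\<lambda>\<pi>. map (grow_core \<pi>) [1..<Suc (Suc k)]"
    have "inj_on ?\<phi> (involutions k)" by (rule inj_onI) (rule grow_core_inj)
    then show ?thesis
      using grow_core_involution unfolding s by (intro exI[of _ ?\<phi>]) blast
  qed
  then obtain \<phi> where \<phi>: "inj_on \<phi> (involutions k)" "\<phi> ` involutions k \<subseteq> involutions (Suc k)"
    "\<And>\<pi>. \<pi> \<in> involutions k \<Longrightarrow> breaks s (\<phi> \<pi>) = breaks s \<pi>" by blast
  have "signed_sum s q k = (\<Sum>\<pi>\<in>\<phi> ` involutions k. q ^ \<Sum>(breaks s \<pi>))"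
    by (simp add: signed_sum_def sum.reindex[OF \<phi>(1)] \<phi>(3))
  also have "\<dots> \<le> signed_sum s q (Suc k)"
    unfolding signed_sum_def using \<phi>(2) q by (intro sum_mono2) auto
  finally show ?thesis .
qed

lemma involutions_0: "involutions 0 = {[]}"
  by (auto simp: involutions_def perms_def)

theorem signed_sum_ratio:
  assumes s: "s = 1 \<or> s = -1" and q: "0 < q" "q < 1"
  shows "(\<lambda>k. signed_sum s q (Suc k) / signed_sum s q k) \<longlonglongrightarrow> 1"
proof -
  have inc: "incseq (signed_sum s q)" by (rule incseq_SucI) (rule signed_sum_mono[OF s q(1)])
  obtain B where B: "\<And>k. signed_sum s q k \<le> B" using signed_sum_bounded[OF s q] by blast
  obtain l where l: "signed_sum s q \<longlonglongrightarrow> l" using incseq_convergent[OF inc] B by blast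
  have "signed_sum s q 0 = 1" by (simp add: signed_sum_def involutions_0 breaks_def)
  then have "1 \<le> l" using incseq_le[OF inc l, of 0] by simp
  then have "(\<lambda>k. signed_sum s q (Suc k) / signed_sum s q k) \<longlonglongrightarrow> l / l"
    by (intro tendsto_divide LIMSEQ_Suc l) simp
  then show ?thesis using \<open>1 \<le> l\<close> by simp
qed

section \<open>Consecutive ratios of the major index sums\<close>

lemma inv_maj_sum_eq_signed: "inv_maj_sum q k = signed_sum 1 q k"
  by (simp add: inv_maj_sum_def signed_sum_def breaks_1 maj_def)

lemma inv_maj_sum_0: "inv_maj_sum q 0 = 1"
  by (simp add: inv_maj_sum_def involutions_0)

lemma inv_maj_sum_pos:
  assumes "0 < q" shows "0 < inv_maj_sum q k"
proof (induction k)
  case (Suc k)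
  then show ?case
    using signed_sum_mono[of 1 q k] assms by (simp add: inv_maj_sum_eq_signed)
qed (simp add: inv_maj_sum_0)

text \<open>Descents and ascents partition \<open>{1..<k}\<close>.\<close>

lemma inv_maj_sum_inverse:
  assumes q: "0 < q"
  shows "inv_maj_sum q k = q ^ \<Sum>{1..<k} * signed_sum (-1) (1 / q) k"
proof -
  have "q ^ maj \<pi> = q ^ \<Sum>{1..<k} * (1 / q) ^ \<Sum>(breaks (-1) \<pi>)" if \<pi>: "\<pi> \<in> involutions k" for \<pi>
  proof -
    have l: "length \<pi> = k" and d: "distinct \<pi>"
      using perms_length perms_distinct involutions_perms[OF \<pi>] by auto
    have "{1..<k} = descents \<pi> \<union> breaks (-1) \<pi>"
    proof (rule set_eqI)
      fix i
      show "i \<in> {1..<k} \<longleftrightarrow> i \<in> descents \<pi> \<union> breaks (-1) \<pi>"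
      proof (cases "1 \<le> i \<and> i < k")
        case True
        then have "\<pi> ! (i - 1) \<noteq> \<pi> ! i"
          using nth_eq_iff_index_eq[OF d, of "i - 1" i] l by (cases i) simp_all
        then show ?thesis using True l by (auto simp: descents_def breaks_def)
      next
        case False
        then show ?thesis using l by (auto simp: descents_def breaks_def)
      qed
    qed
    moreover have "descents \<pi> \<inter> breaks (-1) \<pi> = {}" by (auto simp: descents_def breaks_def)
    moreover have "finite (descents \<pi>)" by (simp add: breaks_1[symmetric])
    ultimately have "\<Sum>{1..<k} = maj \<pi> + \<Sum>(breaks (-1) \<pi>)"
      by (simp add: maj_def sum.union_disjoint)
    then show ?thesis using q by (simp add: power_add power_one_over)
  qed
  then show ?thesis by (simp add: inv_maj_sum_def signed_sum_def sum_distrib_left)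
qed

lemma qint_limit:
  assumes "0 < q" "q < 1"
  shows "(\<lambda>k. qint q (Suc k)) \<longlonglongrightarrow> 1 / (1 - q)"
proof -
  have "(\<lambda>n. \<Sum>i<n. q ^ i) \<longlonglongrightarrow> 1 / (1 - q)"
    using geometric_sums[of q] assms by (simp add: sums_def)
  then show ?thesis unfolding qint_def by (rule LIMSEQ_Suc)
qed

lemma qint_inverse:
  assumes "0 < q" shows "qint q (Suc k) = q ^ k * qint (1 / q) (Suc k)"
proof -
  have "qint q (Suc k) = (\<Sum>i<Suc k. q ^ (k - i))"
    unfolding qint_def using sum.nat_diff_reindex[of "\<lambda>i. q ^ i" "Suc k"] by simp
  also have "\<dots> = (\<Sum>i<Suc k. q ^ k * (1 / q) ^ i)"
    using assms by (intro sum.cong) (auto simp: power_diff power_one_over)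
  finally show ?thesis by (simp only: qint_def sum_distrib_left)
qed

lemma ratio_limit_less_one:
  assumes q: "0 < q" "q < 1"
  shows "(\<lambda>k. inv_maj_sum q (Suc k) / (qint q (Suc k) * inv_maj_sum q k)) \<longlonglongrightarrow> 1 - q"
proof -
  have "(\<lambda>k. inv_maj_sum q (Suc k) / inv_maj_sum q k / qint q (Suc k)) \<longlonglongrightarrow> 1 / (1 / (1 - q))"
    unfolding inv_maj_sum_eq_signed
    using q by (intro tendsto_divide signed_sum_ratio qint_limit) auto
  then show ?thesis by (simp add: mult.commute)
qed

lemma ratio_limit_greater_one:
  assumes q: "1 < q"
  shows "(\<lambda>k. inv_maj_sum q (Suc k) / (qint q (Suc k) * inv_maj_sum q k)) \<longlonglongrightarrow> 1 - 1 / q"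
proof -
  let ?r = "1 / q" and ?U = "signed_sum (-1) (1 / q)"
  have r: "0 < ?r" "?r < 1" using q by simp_all
  have "inv_maj_sum q (Suc k) / (qint q (Suc k) * inv_maj_sum q k)
      = ?U (Suc k) / ?U k / qint ?r (Suc k)" for k
  proof -
    have "\<Sum>{1..<Suc k} = \<Sum>{1..<k} + k" by (cases k) simp_all
    then have "inv_maj_sum q (Suc k) = q ^ \<Sum>{1..<k} * q ^ k * ?U (Suc k)"
      using inv_maj_sum_inverse[of q "Suc k"] q by (simp add: power_add)
    moreover have "inv_maj_sum q k = q ^ \<Sum>{1..<k} * ?U k"
      using inv_maj_sum_inverse[of q k] q by simp
    moreover have "qint q (Suc k) = q ^ k * qint ?r (Suc k)" using qint_inverse[of q k] q by simp
    ultimately show ?thesis using q by (simp add: field_simps)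
  qed
  moreover have "(\<lambda>k. ?U (Suc k) / ?U k / qint ?r (Suc k)) \<longlonglongrightarrow> 1 / (1 / (1 - ?r))"
    using r by (intro tendsto_divide signed_sum_ratio qint_limit) auto
  ultimately show ?thesis by simp
qed

lemma inv_maj_sum_1: "inv_maj_sum 1 k = real (num_involutions k)"
  by (simp add: inv_maj_sum_def num_involutions_def)

lemma num_involutions_0: "num_involutions 0 = 1"
  by (simp add: num_involutions_def involutions_0)

lemma num_involutions_1: "num_involutions 1 = 1"
proof -
  have "involutions 1 = {[1]}" by (auto simp: involutions_def perms_def)
  then show ?thesis by (simp add: num_involutions_def)
qed

text \<open>The case \<open>m = 1\<close>, \<open>q = 1\<close> of \<open>sum_maj_involutions\<close>, where every involution
  has weight \<open>1\<close>.\<close>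

lemma num_involutions_rec:
  "num_involutions (Suc (Suc k)) = num_involutions (Suc k) + Suc k * num_involutions k"
proof -
  have qf: "qfact 1 n = fact n" for n
    by (induction n) (simp_all add: qfact_Suc qint_def)
  have qb: "qbinom 1 (Suc k) (Suc 0) = real (Suc k)" "qbinom 1 (Suc k) 0 = 1"
    by (simp_all add: qbinom_def qf[of "Suc 0"] qf)
  have "real (num_involutions (Suc (Suc k)))
      = (\<Sum>j\<le>1. real (num_involutions j) * real (1 choose j) * qfact 1 (1 - j)
        * qbinom 1 (Suc k) (1 - j) * inv_maj_sum 1 (k + j))"
    using sum_maj_involutions[of 1 1 "Suc (Suc k)"] by (simp add: num_involutions_def)
  also have "\<dots> = real (num_involutions (Suc k)) + real (Suc k) * real (num_involutions k)"
    by (simp add: inv_maj_sum_1 num_involutions_0 num_involutions_1[simplified] qb qf)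
  finally show ?thesis by (metis of_nat_add of_nat_eq_iff of_nat_mult)
qed

text \<open>By the recurrence the ratios satisfy \<open>r\<^bsub>k+1\<^esub> = 1 + (k + 1) / r\<^sub>k\<close>, and a lower bound on one ratio is an
  upper bound on the next; the two bounds must therefore be carried along together.\<close>

lemma num_involutions_ratio_bounds:
  "sqrt (Suc k) * num_involutions k \<le> num_involutions (Suc k)
   \<and> num_involutions (Suc k) \<le> (1 + sqrt (Suc k)) * num_involutions k"
proof (induction k)
  case 0
  then show ?case by (simp add: num_involutions_0 num_involutions_1[simplified])
next
  case (Suc k)
  define s where "s = sqrt (Suc k)"
  define x y where "x = real (num_involutions k)" and "y = real (num_involutions (Suc k))"
  have s: "1 \<le> s" "s ^ 2 = Suc k" by (simp_all add: s_def)
  have xy: "s * x \<le> y" "y \<le> (1 + s) * x" using Suc.IH by (simp_all add: s_def x_def y_def)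
  have x0: "0 \<le> x" "0 \<le> y" by (simp_all add: x_def y_def)
  have rec: "real (num_involutions (Suc (Suc k))) = y + s ^ 2 * x"
    unfolding num_involutions_rec s by (simp add: x_def y_def algebra_simps)
  define t where "t = sqrt (Suc (Suc k))"
  have t: "0 < t" "t ^ 2 = s ^ 2 + 1" by (simp_all add: t_def s)
  have st: "s \<le> t" by (simp add: s_def t_def)
  \<comment> \<open>This is the lower bound \<open>t \<le> 1 + s\<^sup>2 / (1 + s)\<close> on the new ratio, with \<open>t\<^sup>2 = s\<^sup>2 + 1\<close>.\<close>
  have "t * (1 + s) \<le> s ^ 2 + s + 1"
  proof (rule power2_le_imp_le)
    have "(t * (1 + s)) ^ 2 = (s ^ 2 + 1) * (1 + s) ^ 2" by (simp add: power_mult_distrib t)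
    also have "\<dots> \<le> (s ^ 2 + s + 1) ^ 2" by (simp add: power2_eq_square algebra_simps)
    finally show "(t * (1 + s)) ^ 2 \<le> (s ^ 2 + s + 1) ^ 2" .
  qed (use s in simp)
  then have "t - 1 \<le> s ^ 2 / (1 + s)" using s by (simp add: field_simps)
  moreover have "y / (1 + s) \<le> x" using xy(2) s by (simp add: field_simps)
  ultimately have "(t - 1) * y \<le> s ^ 2 * x"
  proof -
    assume 1: "t - 1 \<le> s ^ 2 / (1 + s)" and 2: "y / (1 + s) \<le> x"
    have "(t - 1) * y \<le> s ^ 2 / (1 + s) * y" using 1 x0(2) by (rule mult_right_mono)
    also have "\<dots> = s ^ 2 * (y / (1 + s))" by simp
    also have "\<dots> \<le> s ^ 2 * x" using 2 by (rule mult_left_mono) simp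
    finally show ?thesis .
  qed
  then have low: "t * y \<le> y + s ^ 2 * x" by (simp add: algebra_simps)
  have "s ^ 2 * x \<le> s * y" using mult_left_mono[OF xy(1), of s] s(1) by (simp add: power2_eq_square mult.assoc)
  also have "\<dots> \<le> t * y" using st x0 by (simp add: mult_right_mono)
  finally have "y + s ^ 2 * x \<le> (1 + t) * y" by (simp add: algebra_simps)
  with low show ?case unfolding rec by (simp add: t_def y_def)
qed

lemma ratio_limit_one:
  "(\<lambda>k. inv_maj_sum 1 (Suc k) / (qint 1 (Suc k) * inv_maj_sum 1 k)) \<longlonglongrightarrow> 0"
proof (rule tendsto_sandwich[of "\<lambda>_. 0" _ _ "\<lambda>k. (1 + sqrt (Suc k)) / Suc k"])
  show "\<forall>\<^sub>F k in sequentially. inv_maj_sum 1 (Suc k) / (qint 1 (Suc k) * inv_maj_sum 1 k)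
      \<le> (1 + sqrt (Suc k)) / Suc k"
  proof (rule always_eventually, rule allI)
    fix k
    have p: "0 < inv_maj_sum 1 k" by (rule inv_maj_sum_pos) simp
    have "inv_maj_sum 1 (Suc k) \<le> (1 + sqrt (Suc k)) * inv_maj_sum 1 k"
      using num_involutions_ratio_bounds[of k] by (simp add: inv_maj_sum_1)
    then have "inv_maj_sum 1 (Suc k) / inv_maj_sum 1 k \<le> 1 + sqrt (Suc k)"
      using p by (simp add: divide_le_eq)
    then have "inv_maj_sum 1 (Suc k) / inv_maj_sum 1 k / Suc k \<le> (1 + sqrt (Suc k)) / Suc k"
      by (rule divide_right_mono) simp
    moreover have "qint 1 (Suc k) = Suc k" by (simp add: qint_def)
    ultimately show "inv_maj_sum 1 (Suc k) / (qint 1 (Suc k) * inv_maj_sum 1 k)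
      \<le> (1 + sqrt (Suc k)) / Suc k"
      by (simp add: mult.commute)
  qed
  show "\<forall>\<^sub>F k in sequentially. 0 \<le> inv_maj_sum 1 (Suc k) / (qint 1 (Suc k) * inv_maj_sum 1 k)"
    using inv_maj_sum_pos[of 1] qint_pos[of 1]
    by (intro always_eventually allI divide_nonneg_nonneg mult_nonneg_nonneg less_imp_le) auto
  have "(\<lambda>k. inverse (real (Suc k)) + sqrt (inverse (real (Suc k)))) \<longlonglongrightarrow> 0 + sqrt 0"
    by (intro tendsto_add tendsto_real_sqrt LIMSEQ_inverse_real_of_nat)
  moreover have "(1 + sqrt (Suc k)) / Suc k = inverse (real (Suc k)) + sqrt (inverse (real (Suc k)))" for k
  proof -
    have "sqrt (real (Suc k)) / real (Suc k) = inverse (sqrt (real (Suc k)))"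
      by (rule sqrt_divide_self_eq) simp
    then show ?thesis
      unfolding add_divide_distrib by (simp only: real_sqrt_inverse) (simp only: inverse_eq_divide)
  qed
  ultimately show "(\<lambda>k. (1 + sqrt (real (Suc k))) / real (Suc k)) \<longlonglongrightarrow> 0"
    by simp
qed simp

theorem ratio_limit:
  assumes q: "0 < q"
  shows "(\<lambda>k. inv_maj_sum q (Suc k) / (qint q (Suc k) * inv_maj_sum q k)) \<longlonglongrightarrow> 1 - min q (inverse q)"
proof -
  consider "q < 1" | "q = 1" | "1 < q" by linarith
  then show ?thesis
  proof cases
    case 1
    then have "min q (inverse q) = q" using q by (simp add: min_def field_simps power2_eq_square[symmetric] power_le_one)
    then show ?thesis using ratio_limit_less_one[OF q 1] by simp
  next
    case 2
    then show ?thesis using ratio_limit_one by simp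
  next
    case 3
    then have "inverse q \<le> 1" by (simp add: inverse_le_1_iff)
    then have "min q (inverse q) = inverse q" using 3 by simp
    then show ?thesis using ratio_limit_greater_one[OF 3] by (simp add: inverse_eq_divide)
  qed
qed

definition normalized_sum :: "real \<Rightarrow> nat \<Rightarrow> real" where
  "normalized_sum q k = inv_maj_sum q k / qfact q k"

lemma normalized_sum_pos: "0 < q \<Longrightarrow> 0 < normalized_sum q k"
  by (simp add: normalized_sum_def inv_maj_sum_pos qfact_pos)

lemma normalized_sum_ratio_limit:
  assumes q: "0 < q"
  shows "(\<lambda>N. normalized_sum q (N + j) / normalized_sum q N) \<longlonglongrightarrow> (1 - min q (inverse q)) ^ j"
proof (induction j)
  case 0
  have "normalized_sum q N / normalized_sum q N = 1" for N
    using normalized_sum_pos[OF q, of N] by simp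
  then show ?case by simp
next
  case (Suc j)
  have step: "normalized_sum q (Suc k) / normalized_sum q k
      = inv_maj_sum q (Suc k) / (qint q (Suc k) * inv_maj_sum q k)" for k
    using qfact_pos[OF q, of k] by (simp add: normalized_sum_def qfact_Suc)
  have "(\<lambda>N. normalized_sum q (Suc (N + j)) / normalized_sum q (N + j)) \<longlonglongrightarrow> 1 - min q (inverse q)"
    unfolding step using ratio_limit[OF q] by (rule LIMSEQ_ignore_initial_segment)
  from tendsto_mult[OF this Suc.IH]
  have "(\<lambda>N. normalized_sum q (Suc (N + j)) / normalized_sum q (N + j)
        * (normalized_sum q (N + j) / normalized_sum q N)) \<longlonglongrightarrow> (1 - min q (inverse q)) ^ Suc j"
    by simp
  moreover have "normalized_sum q (Suc (N + j)) / normalized_sum q (N + j)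
        * (normalized_sum q (N + j) / normalized_sum q N) = normalized_sum q (N + Suc j) / normalized_sum q N" for N
    using normalized_sum_pos[OF q, of "N + j"] by simp
  ultimately show ?case by (simp only:)
qed

section \<open>The limit\<close>

lemma qbinom_inv_maj_sum:
  assumes q: "0 < q" and n: "2 * m \<le> n" and j: "j \<le> m"
  shows "qbinom q (n - m) (m - j) * inv_maj_sum q (n - 2 * m + j)
    = qfact q (n - m) / qfact q (m - j) * normalized_sum q (n - 2 * m + j)"
proof -
  have "n - m - (m - j) = n - 2 * m + j" using n j by simp
  then show ?thesis by (simp only: qbinom_def normalized_sum_def) simp
qed

text \<open>Both sums are divided by \<open>qfact q (n - m) * normalized_sum q (n - 2 * m)\<close>. The denominator has a
  nonzero limit because its summand for \<open>j = 0\<close> is \<open>1\<close> and the others are nonnegative.\<close>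

theorem limit_quotient:
  fixes q :: real
  assumes \<sigma>: "\<sigma> \<in> perms m" and q: "0 < q"
  defines "L \<equiv> 1 - min q (inverse q)"
  shows "(\<lambda>n. (\<Sum>\<pi>\<in>involutions_over n \<sigma>. q ^ maj (pos_after m \<pi>)) /
               (\<Sum>\<pi>\<in>involutions n. q ^ maj (pos_after m \<pi>)))
    \<longlonglongrightarrow> (\<Sum>j\<in>J \<sigma>. q ^ maj (drop j \<sigma>) / qfact q (m - j) * L ^ j)
      / (\<Sum>j\<le>m. real (num_involutions j) * real (m choose j) * L ^ j)"
proof -
  let ?a = "normalized_sum q"
  define num where "num N = (\<Sum>j\<in>J \<sigma>. q ^ maj (drop j \<sigma>) / qfact q (m - j) * (?a (N + j) / ?a N))" for N
  define den where "den N = (\<Sum>j\<le>m. real (num_involutions j) * real (m choose j) * (?a (N + j) / ?a N))" for N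
  have "q \<le> 1 \<or> inverse q \<le> 1" by (cases "q \<le> 1") (simp_all add: inverse_le_1_iff)
  then have "0 \<le> L" by (simp add: L_def min_le_iff_disj)
  then have "0 \<le> (\<Sum>j\<in>{..m} - {0}. real (num_involutions j) * real (m choose j) * L ^ j)"
    by (intro sum_nonneg) simp
  then have den0: "(\<Sum>j\<le>m. real (num_involutions j) * real (m choose j) * L ^ j) \<noteq> 0"
    by (subst sum.remove[of _ 0]) (simp_all add: num_involutions_0)
  have "(\<lambda>N. num N / den N) \<longlonglongrightarrow> (\<Sum>j\<in>J \<sigma>. q ^ maj (drop j \<sigma>) / qfact q (m - j) * L ^ j)
      / (\<Sum>j\<le>m. real (num_involutions j) * real (m choose j) * L ^ j)"
    unfolding num_def den_def L_def
    by (intro tendsto_divide tendsto_sum tendsto_mult tendsto_const normalized_sum_ratio_limit[OF q])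
      (use den0 in \<open>simp add: L_def\<close>)
  moreover have "num N / den N = (\<Sum>\<pi>\<in>involutions_over (N + 2 * m) \<sigma>. q ^ maj (pos_after m \<pi>)) /
               (\<Sum>\<pi>\<in>involutions (N + 2 * m). q ^ maj (pos_after m \<pi>))" for N
  proof -
    let ?n = "N + 2 * m"
    let ?c = "qfact q (?n - m) * ?a N"
    have c: "?c \<noteq> 0" using qfact_pos[OF q, of "?n - m"] normalized_sum_pos[OF q, of N] by simp
    have aN: "?a N \<noteq> 0" using normalized_sum_pos[OF q, of N] by simp
    have summand: "qbinom q (?n - m) (m - j) * inv_maj_sum q (N + j)
        = ?c * (1 / qfact q (m - j) * (?a (N + j) / ?a N))" if "j \<le> m" for j
      using qbinom_inv_maj_sum[OF q, of m ?n j] that aN by simp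
    have "(\<Sum>\<pi>\<in>involutions_over ?n \<sigma>. q ^ maj (pos_after m \<pi>))
        = (\<Sum>j\<in>J \<sigma>. q ^ maj (drop j \<sigma>) * (qbinom q (?n - m) (m - j) * inv_maj_sum q (N + j)))"
      using sum_maj_involutions_over[OF q \<sigma>, of ?n] by (simp add: mult.assoc)
    also have "\<dots> = (\<Sum>j\<in>J \<sigma>. ?c * (q ^ maj (drop j \<sigma>) / qfact q (m - j) * (?a (N + j) / ?a N)))"
    proof (rule sum.cong[OF refl])
      fix j assume "j \<in> J \<sigma>"
      then have "j \<le> m" using J_bound perms_length[OF \<sigma>] by blast
      then show "q ^ maj (drop j \<sigma>) * (qbinom q (?n - m) (m - j) * inv_maj_sum q (N + j))
          = ?c * (q ^ maj (drop j \<sigma>) / qfact q (m - j) * (?a (N + j) / ?a N))"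
        unfolding summand[OF \<open>j \<le> m\<close>] by (simp only: divide_inverse mult_1 ac_simps)
    qed
    also have "\<dots> = ?c * num N" by (simp only: num_def sum_distrib_left)
    finally have n: "(\<Sum>\<pi>\<in>involutions_over ?n \<sigma>. q ^ maj (pos_after m \<pi>)) = ?c * num N" .
    have "(\<Sum>\<pi>\<in>involutions ?n. q ^ maj (pos_after m \<pi>))
        = (\<Sum>j\<le>m. real (num_involutions j) * real (m choose j) * qfact q (m - j)
            * (qbinom q (?n - m) (m - j) * inv_maj_sum q (N + j)))"
      using sum_maj_involutions[OF q, of m ?n] by (simp add: mult.assoc)
    also have "\<dots> = (\<Sum>j\<le>m. ?c * (real (num_involutions j) * real (m choose j) * (?a (N + j) / ?a N)))"
    proof (rule sum.cong[OF refl])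
      fix j assume "j \<in> {..m}"
      then have j: "j \<le> m" by simp
      have "qfact q (m - j) \<noteq> 0" using qfact_pos[OF q, of "m - j"] by simp
      then show "real (num_involutions j) * real (m choose j) * qfact q (m - j)
            * (qbinom q (?n - m) (m - j) * inv_maj_sum q (N + j))
          = ?c * (real (num_involutions j) * real (m choose j) * (?a (N + j) / ?a N))"
        unfolding summand[OF j] by simp
    qed
    also have "\<dots> = ?c * den N" by (simp only: den_def sum_distrib_left)
    finally have d: "(\<Sum>\<pi>\<in>involutions ?n. q ^ maj (pos_after m \<pi>)) = ?c * den N" .
    show ?thesis unfolding n d using c by (rule mult_divide_mult_cancel_left[symmetric])
  qed
  ultimately show ?thesis by (simp add: LIMSEQ_offset[where k = "2 * m"])
qed

text \<open>The second form is \<open>limit_quotient\<close> with numerator and denominator multiplied by \<open>qfact q m\<close>; the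
  first form results from splitting off the summand for \<open>j = 0\<close> in both sums.\<close>

theorem theorem1p2:
  fixes \<sigma> :: "nat list" and m :: nat and q qb C D :: real
  assumes sigma: "\<sigma> \<in> perms m"
    and q_pos: "q > 0"
    and qb_eq: "qb = min q (inverse q)"
    and C_eq: "C = (\<Sum>j\<in>{j \<in> J \<sigma>. j \<ge> 1}.
        q ^ maj (pos_after j \<sigma>) * qbinom q m j * qfact q j * (1 - qb) ^ (j - 1))"
    and D_eq: "D = qfact q m *
        (\<Sum>j=1..m. real (num_involutions j) * real (m choose j) * (1 - qb) ^ (j - 1))"
  shows "((\<lambda>n. (\<Sum>\<pi>\<in>involutions_over n \<sigma>. q ^ maj (pos_after m \<pi>)) /
               (\<Sum>\<pi>\<in>involutions n. q ^ maj (pos_after m \<pi>)))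
          \<longlonglongrightarrow> (q ^ maj \<sigma> + (1 - qb) * C) / (qfact q m + (1 - qb) * D))
    \<and> ((\<lambda>n. (\<Sum>\<pi>\<in>involutions_over n \<sigma>. q ^ maj (pos_after m \<pi>)) /
               (\<Sum>\<pi>\<in>involutions n. q ^ maj (pos_after m \<pi>)))
          \<longlonglongrightarrow> (\<Sum>j\<in>J \<sigma>. q ^ maj (pos_after j \<sigma>) * qbinom q m j * qfact q j * (1 - qb) ^ j) /
              (\<Sum>j=0..m. qfact q m * real (num_involutions j) * real (m choose j) * (1 - qb) ^ j))"
proof -
  define L where "L = 1 - qb"
  let ?num = "\<Sum>j\<in>J \<sigma>. q ^ maj (pos_after j \<sigma>) * qbinom q m j * qfact q j * L ^ j"
  let ?den = "\<Sum>j=0..m. qfact q m * real (num_involutions j) * real (m choose j) * L ^ j"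
  have qf: "qfact q i \<noteq> 0" for i using qfact_pos[OF q_pos, of i] by simp
  have num: "?num = qfact q m * (\<Sum>j\<in>J \<sigma>. q ^ maj (drop j \<sigma>) / qfact q (m - j) * L ^ j)"
    unfolding sum_distrib_left
  proof (rule sum.cong[OF refl])
    fix j
    have "qbinom q m j * qfact q j = qfact q m / qfact q (m - j)" using qf by (simp add: qbinom_def)
    then show "q ^ maj (pos_after j \<sigma>) * qbinom q m j * qfact q j * L ^ j
        = qfact q m * (q ^ maj (drop j \<sigma>) / qfact q (m - j) * L ^ j)"
      by (simp add: pos_after_def maj_std mult.assoc)
  qed
  have den: "?den = qfact q m * (\<Sum>j\<le>m. real (num_involutions j) * real (m choose j) * L ^ j)"
    by (simp add: sum_distrib_left atLeast0AtMost mult.assoc)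
  have lim: "((\<lambda>n. (\<Sum>\<pi>\<in>involutions_over n \<sigma>. q ^ maj (pos_after m \<pi>)) /
               (\<Sum>\<pi>\<in>involutions n. q ^ maj (pos_after m \<pi>))) \<longlonglongrightarrow> ?num / ?den)"
    unfolding num den mult_divide_mult_cancel_left[OF qf]
    using limit_quotient[OF sigma q_pos] by (simp add: L_def qb_eq)
  have "0 \<in> J \<sigma>" by (simp add: J_def pos_upto_def std_def involutions_0)
  then have "?num = q ^ maj (pos_after 0 \<sigma>) * qbinom q m 0
      + (\<Sum>j\<in>J \<sigma> - {0}. q ^ maj (pos_after j \<sigma>) * qbinom q m j * qfact q j * L ^ j)"
    by (subst sum.remove[of _ 0]) simp_all
  also have "(\<Sum>j\<in>J \<sigma> - {0}. q ^ maj (pos_after j \<sigma>) * qbinom q m j * qfact q j * L ^ j) = L * C"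
    unfolding C_eq sum_distrib_left
  proof (rule sum.cong)
    show "J \<sigma> - {0} = {j \<in> J \<sigma>. j \<ge> 1}" by auto
    fix j assume "j \<in> {j \<in> J \<sigma>. j \<ge> 1}"
    then have "L ^ j = L * (1 - qb) ^ (j - 1)" by (cases j) (simp_all add: L_def)
    then show "q ^ maj (pos_after j \<sigma>) * qbinom q m j * qfact q j * L ^ j
        = L * (q ^ maj (pos_after j \<sigma>) * qbinom q m j * qfact q j * (1 - qb) ^ (j - 1))" by simp
  qed
  also have "q ^ maj (pos_after 0 \<sigma>) * qbinom q m 0 = q ^ maj \<sigma>"
    using q_pos by (simp add: pos_after_def maj_std)
  finally have num': "?num = q ^ maj \<sigma> + L * C" .
  have "?den = qfact q m + (\<Sum>j=1..m. qfact q m * real (num_involutions j) * real (m choose j) * L ^ j)"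
    by (subst sum.atLeast_Suc_atMost) (simp_all add: num_involutions_0)
  also have "(\<Sum>j=1..m. qfact q m * real (num_involutions j) * real (m choose j) * L ^ j) = L * D"
    unfolding D_eq sum_distrib_left
  proof (rule sum.cong[OF refl])
    fix j assume "j \<in> {1..m}"
    then have "L ^ j = L * (1 - qb) ^ (j - 1)" by (cases j) (simp_all add: L_def)
    then show "qfact q m * real (num_involutions j) * real (m choose j) * L ^ j
        = L * (qfact q m * (real (num_involutions j) * real (m choose j) * (1 - qb) ^ (j - 1)))" by simp
  qed
  finally have den': "?den = qfact q m + L * D" .
  from lim show ?thesis unfolding num'[symmetric, unfolded L_def] den'[symmetric, unfolded L_def]
    by (simp add: L_def)
qed

end
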